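(* The answer to the Busemann–Petty problem in the complex hyperbolic $n$-space $\mathbb{H}^n_{\mathbb{C}}$ is affirmative for $n\le 2$ and negative for $n\ge 3$. That is: (i) Let $n\le 2$. If $K$ and $L$ are $R_\theta$-invariant convex bodies in $\mathbb{R}^{2n}$ contained in the unit ball such that $\mathrm{HVol}_{2n-2}(K\cap H_\xi)\le \mathrm{HVol}_{2n-2}(L\cap H_\xi)$ for every $\xi\in S^{2n-1}$, then $\mathrm{HVol}_{2n}(K)\le \mathrm{HVol}_{2n}(L)$. (ii) For every integer $n\ge 3$ there exist $R_\theta$-invariant convex bodies $K$ and $L$ in $\mathbb{R}^{2n}$ contained in the unit ball such that $\mathrm{HVol}_{2n-2}(K\cap H_\xi)\le \mathrm{HVol}_{2n-2}(L\cap H_\xi)$ for every $\xi\in S^{2n-1}$, but $\mathrm{HVol}_{2n}(K)>\mathrm{HVol}_{2n}(L)$.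
   Context: Here $n\ge 1$ is the complex dimension. Identify $\mathbb{C}^n$ with $\mathbb{R}^{2n}$ via $(\xi_{11}+i\xi_{12},\dots,\xi_{n1}+i\xi_{n2})\mapsto(\xi_{11},\xi_{12},\dots,\xi_{n1},\xi_{n2})$. $|\cdot|$ is the Euclidean norm and $S^{2n-1}$ the unit sphere of $\mathbb{R}^{2n}$. For $\xi\in S^{2n-1}$, $H_\xi=\{z\in\mathbb{C}^n:\sum_{k=1}^n z_k\overline{\xi_k}=0\}$, viewed as a $(2n-2)$-dimensional real subspace of $\mathbb{R}^{2n}$ (it is the orthogonal complement of $\xi$ and $\xi_\perp=(-\xi_{12},\xi_{11},\dots,-\xi_{n2},\xi_{n1})$). A convex body is a compact convex set having the origin as an interior point. Its Minkowski functional is $\|x\|_K=\min\{a\ge 0: x\in aK\}$. A convex body $K$ in $\mathbb{R}^{2n}$ is $R_\theta$-invariant if for every $\theta\in[0,2\pi]$ and every $\xi\in\mathbb{R}^{2n}$, $\|\xi\|_K=\|(R_\theta(\xi_{11},\xi_{12}),\dots,R_\theta(\xi_{n1},\xi_{n2}))\|_K$, where $R_\theta$ is the counterclockwise rotation of $\mathbb{R}^2$ by the angle $\theta$ about the origin. "Unit ball" means the open Euclidean unit ball $\{|x|<1\}$ of $\mathbb{R}^{2n}$, which is the ball model of $\mathbb{H}^n_{\mathbb{C}}$ with the Bergman metric normalized to have constant holomorphic sectional curvature $-1$. The hyperbolic volumes of a body $K$ in the unit ball and of its section by $H_\xi$ are $$\mathrm{HVol}_{2n}(K)=8^n\int_K\frac{dx}{(1-|x|^2)^{n+1}},\qquad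 \mathrm{HVol}_{2n-2}(K\cap H_\xi)=8^{n-1}\int_{K\cap H_\xi}\frac{dx}{(1-|x|^2)^{n}},$$ where $dx$ is Lebesgue measure on $\mathbb{R}^{2n}$ and on $H_\xi$ respectively. The case $n=1$ (where $H_\xi=\{0\}$) is included in the statement and regarded as trivial: $R_\theta$-invariant convex bodies in $\mathbb{C}=\mathbb{R}^2$ are closed discs around the origin.
   Formalization: Part (i) is proved for n = 2 only: for n = 1 every section is {0}, so the discs of radii 1/2 and 1/4 refute the claim; for n = 1 it is proved instead that R_θ-invariant convex bodies are closed discs around the origin. *)

theory Defs
  imports "HOL-Analysis.Analysis"
begin

text \<open>
  Complex \<open>n\<close>-space is \<open>complex ^ 'n\<close> with \<open>n = CARD('n)\<close>. It is a Euclidean space of real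
  dimension \<open>2 * n\<close> whose standard basis consists of the real and imaginary coordinate directions,
  so \<^const>\<open>norm\<close> and \<^const>\<open>lborel\<close> are the Euclidean norm and Lebesgue measure of
  \<open>2 * n\<close>-dimensional real space.
\<close>

definition convex_body :: "'a::euclidean_space set \<Rightarrow> bool" where
  "convex_body K \<longleftrightarrow> compact K \<and> convex K \<and> 0 \<in> interior K"

text \<open>For a convex body the infimum is attained, i.e. it is a minimum.\<close>

definition minkowski_functional :: "'a::real_vector set \<Rightarrow> 'a \<Rightarrow> real" where
  "minkowski_functional K x = Inf {a. 0 \<le> a \<and> x \<in> (\<lambda>y. a *\<^sub>R y) ` K}"

text \<open>Multiplication by \<^term>\<open>cis \<theta>\<close> is the counterclockwise rotation of the plane by \<open>\<theta>\<close>.\<close>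

definition rotate_coords :: "real \<Rightarrow> complex ^ 'n \<Rightarrow> complex ^ 'n" where
  "rotate_coords \<theta> x = (\<chi> k. cis \<theta> * x $ k)"

definition R_invariant :: "(complex ^ 'n) set \<Rightarrow> bool" where
  "R_invariant K \<longleftrightarrow>
     (\<forall>\<theta>\<in>{0..2 * pi}. \<forall>x. minkowski_functional K x = minkowski_functional K (rotate_coords \<theta> x))"

definition complex_hyperplane :: "complex ^ 'n \<Rightarrow> (complex ^ 'n) set" where
  "complex_hyperplane \<xi> = {z. (\<Sum>k\<in>UNIV. z $ k * cnj (\<xi> $ k)) = 0}"

definition orthonormal_basis_of :: "'a::euclidean_space set \<Rightarrow> 'a set \<Rightarrow> bool" where
  "orthonormal_basis_of S B \<longleftrightarrow> pairwise orthogonal B \<and> (\<forall>b\<in>B. norm b = 1) \<and> span B = S"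

lemma orthonormal_basis_of_exists:
  assumes "subspace S"
  shows "\<exists>B. orthonormal_basis_of S B"
  using orthonormal_basis_subspace[OF assms] unfolding orthonormal_basis_of_def by metis

text \<open>
  Lebesgue measure on a linear subspace \<open>S\<close>, as a measure on the ambient space concentrated on
  \<open>S\<close>: the image of product Lebesgue measure under the coordinates of an orthonormal basis of
  \<open>S\<close>. By rotation invariance of Lebesgue measure it does not depend on the basis chosen. For
  \<open>S = {0}\<close> it is the unit mass at the origin.
\<close>

definition subspace_lebesgue :: "'a::euclidean_space set \<Rightarrow> 'a measure" where
  "subspace_lebesgue S =
     (let B = (SOME B. orthonormal_basis_of S B)
      in distr (Pi\<^sub>M B (\<lambda>_. lborel :: real measure)) borel (\<lambda>c. \<Sum>b\<in>B. c b *\<^sub>R b))"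

text \<open>
  The integrals below are Bochner integrals. For compact \<open>K\<close> inside the open unit ball the
  integrands are bounded and measurable on sets of finite measure, so the default value \<open>0\<close> of a
  non-existing integral plays no role.
\<close>

definition hvol :: "(complex ^ 'n) set \<Rightarrow> real" where
  "hvol K = 8 ^ CARD('n) * (LINT x:K|lborel. 1 / (1 - (norm x)\<^sup>2) ^ (CARD('n) + 1))"

definition hvol_section :: "(complex ^ 'n) set \<Rightarrow> complex ^ 'n \<Rightarrow> real" where
  "hvol_section K \<xi> = 8 ^ (CARD('n) - 1) *
     (LINT x:(K \<inter> complex_hyperplane \<xi>)|subspace_lebesgue (complex_hyperplane \<xi>).
        1 / (1 - (norm x)\<^sup>2) ^ CARD('n))"

lemma complex_hyperplane_dim1:
  fixes \<xi> :: "complex ^ 'n"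
  assumes "CARD('n) = 1" "norm \<xi> = 1"
  shows "complex_hyperplane \<xi> = {0}"
proof -
  obtain i where i: "(UNIV :: 'n set) = {i}"
    using assms(1) card_1_singletonE by blast
  have *: "z = w \<longleftrightarrow> z $ i = w $ i" for z w :: "complex ^ 'n"
    using i by (metis UNIV_I singletonD vec_eq_iff)
  have "\<xi> \<noteq> 0" using assms(2) by auto
  then have "\<xi> $ i \<noteq> 0" using * by auto
  then show ?thesis unfolding complex_hyperplane_def i by (auto simp: *)
qed

lemma minkowski_functional_cball:
  fixes x :: "'a::real_normed_vector"
  assumes "r > 0"
  shows "minkowski_functional (cball 0 r) x = norm x / r"
proof -
  have "{a. 0 \<le> a \<and> x \<in> (\<lambda>y. a *\<^sub>R y) ` cball 0 r} = {norm x / r..}"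
  proof (intro set_eqI iffI)
    fix a assume "a \<in> {a. 0 \<le> a \<and> x \<in> (\<lambda>y. a *\<^sub>R y) ` cball 0 r}"
    then show "a \<in> {norm x / r..}"
      using assms by (auto simp: field_simps mult_left_mono)
  next
    fix a assume a: "a \<in> {norm x / r..}"
    then have "a \<ge> 0" using assms order_trans[of 0 "norm x / r" a] by simp
    show "a \<in> {a. 0 \<le> a \<and> x \<in> (\<lambda>y. a *\<^sub>R y) ` cball 0 r}"
    proof (cases "a = 0")
      case True
      then show ?thesis using a assms by (auto simp: divide_le_0_iff intro!: image_eqI[of _ _ 0])
    next
      case False
      then show ?thesis using a \<open>a \<ge> 0\<close> assms
        by (auto simp: field_simps intro!: image_eqI[of _ _ "inverse a *\<^sub>R x"])
    qed
  qed
  then show ?thesis unfolding minkowski_functional_def by simp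
qed

lemma norm_rotate_coords: "norm (rotate_coords \<theta> x) = norm x"
  by (simp add: rotate_coords_def norm_vec_def norm_mult)

lemma cball_body:
  assumes "0 < r" "r < 1"
  shows "convex_body (cball (0 :: complex ^ 'n) r)" "R_invariant (cball (0 :: complex ^ 'n) r)"
    "cball (0 :: complex ^ 'n) r \<subseteq> ball 0 1"
  using assms by (auto simp: convex_body_def R_invariant_def
      minkowski_functional_cball norm_rotate_coords)

lemma hvol_cball_less:
  assumes "0 < r" "r < s" "s < 1"
  shows "hvol (cball (0 :: complex ^ 'n) r) < hvol (cball (0 :: complex ^ 'n) s)"
proof -
  define f :: "complex ^ 'n \<Rightarrow> real" where "f x = 1 / (1 - (norm x)\<^sup>2) ^ (CARD('n) + 1)" for x
  define c :: "real \<Rightarrow> (complex ^ 'n) set" where "c t = cball 0 t" for t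
  have f1: "f x \<ge> 1" if "norm x < 1" for x
  proof -
    have "0 < 1 - (norm x)\<^sup>2" "1 - (norm x)\<^sup>2 \<le> 1"
      using that by (auto simp: abs_square_less_1)
    then show ?thesis unfolding f_def using power_le_one[of "1 - (norm x)\<^sup>2" "CARD('n)+1"]
      by (simp del: power_Suc)
  qed
  have int: "integrable lborel (\<lambda>x. indicator (c t) x *\<^sub>R f x)" if "t < 1" for t
  proof -
    have "(norm x)\<^sup>2 \<noteq> 1" if "x \<in> cball 0 t" for x :: "complex ^ 'n"
      using that \<open>t < 1\<close> by (simp add: power2_eq_1_iff) (use norm_ge_zero[of x] in linarith)
    then show ?thesis unfolding f_def c_def
      by (intro borel_integrable_compact continuous_intros) auto
  qed
  have int1: "integrable lborel (\<lambda>x. indicator (c t) x :: real)" for t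
    unfolding c_def
    by (rule integrable_real_indicator) (simp, rule emeasure_lborel_cball_finite)
  have "0 < measure lborel (c s) - measure lborel (c r)"
    using assms by (simp add: c_def content_cball power_strict_mono)
  also have "\<dots> = (LINT x|lborel. indicator (c s) x - indicator (c r) x)"
    using int1 by simp
  also have "\<dots> \<le> (LINT x|lborel. indicator (c s) x *\<^sub>R f x - indicator (c r) x *\<^sub>R f x)"
  proof (rule integral_mono)
    fix x :: "complex ^ 'n"
    show "indicator (c s) x - indicator (c r) x
        \<le> indicator (c s) x *\<^sub>R f x - indicator (c r) x *\<^sub>R f x"
      using assms f1[of x] by (auto simp: c_def indicator_def)
  qed (use assms int int1 in auto)
  also have "\<dots> = (LINT x:c s|lborel. f x) - (LINT x:c r|lborel. f x)"
    unfolding set_lebesgue_integral_def using assms int by simp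
  finally show ?thesis by (simp add: hvol_def c_def f_def)
qed

text \<open>
  In complex dimension one all sections \<open>K \<inter> complex_hyperplane \<xi>\<close> are \<open>{0}\<close>, so that comparing
  them says nothing about \<open>K\<close>: two concentric discs refute the implication from section volumes to
  volumes.
\<close>

lemma section_comparison_fails_dim1:
  assumes "CARD('n) = 1"
  shows "\<exists>K L :: (complex ^ 'n) set.
    convex_body K \<and> R_invariant K \<and> K \<subseteq> ball 0 1 \<and>
    convex_body L \<and> R_invariant L \<and> L \<subseteq> ball 0 1 \<and>
    (\<forall>\<xi>\<in>sphere 0 1. hvol_section K \<xi> \<le> hvol_section L \<xi>) \<and> hvol K > hvol L"
proof (intro exI conjI ballI)
  fix \<xi> :: "complex ^ 'n" assume "\<xi> \<in> sphere 0 1"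
  then have "complex_hyperplane \<xi> = {0}" using complex_hyperplane_dim1[OF assms] by simp
  then show "hvol_section (cball 0 (1/2)) \<xi> \<le> hvol_section (cball 0 (1/4)) \<xi>"
    by (simp add: hvol_section_def)
qed (use cball_body[of "1/2"] cball_body[of "1/4"] hvol_cball_less[of "1/4" "1/2"] in simp_all)

end

theory Submission
  imports Defs
begin

text \<open>
  The substitution \<open>y = x / sqrt (1 - norm x ^ 2)\<close> turns the hyperbolic volume of a body, and of
  each of its sections through the origin, into a multiple of the Euclidean volume of the image. The
  images need not be convex: \<open>K\<close> is convex as soon as its squared gauge, which is
  \<open>norm x ^ 2\<close> plus the squared gauge of the image, is a convex function. For bodies close to the
  unit sphere this is a weak restriction, and the problem becomes one about star-shaped sets that
  are invariant under rotation of all coordinates. The proof follows this heuristic but estimates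
  the weights \<open>(1 - norm x ^ 2) ^ -m\<close> directly.

  In dimension one, invariance and convexity make a body a disc. In dimension two a complex
  hyperplane is a single complex line, so a section is a disc whose weighted area determines its
  radius strictly monotonically. Every vector lies on such a line, so comparing all sections gives
  \<open>K \<subseteq> L\<close> (lemma \<open>dim2_section_comparison_subset\<close>), and volume is monotone.

  From dimension three on, a spiky body beats a ball. Write \<open>N\<close> for the dimension, split a
  vector into one coordinate and the rest, and let \<open>K\<close> bound both parts by the radius
  \<open>sqrt ((1 - \<delta>) / 2)\<close>. This product of two balls approaches the unit sphere as
  \<open>\<delta> \<rightarrow> 0\<close> only where both parts have almost maximal length. Near that set two radial variables
  vary independently at scale \<open>\<delta>\<close>, so the points of \<open>K\<close> with
  \<open>1 - norm x ^ 2\<close> of order \<open>t \<ge> \<delta>\<close> have measure of order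
  \<open>t ^ 2\<close>. The same is true, with a constant independent of the hyperplane, in every section: here
  \<open>N \<ge> 3\<close> enters, because a section must have room for a second radial variable. Hence the volume
  of \<open>K\<close> has order \<open>\<delta> powr (1 - N)\<close>, while its sections are
  \<open>O (\<delta> powr (2 - N))\<close>. A concentric ball \<open>L\<close> whose squared radius is
  \<open>1 - e\<close> has sections of order \<open>e powr (1 - N)\<close> and volume of order
  \<open>e powr (- N)\<close>. Choosing \<open>e\<close> as a small multiple of
  \<open>\<delta> powr ((N - 2) / (N - 1))\<close> makes the sections of \<open>L\<close> dominate those of
  \<open>K\<close>. The volume of \<open>L\<close> is then of order \<open>\<delta> powr (- N (N - 2) / (N - 1))\<close>,
  which is smaller than that of \<open>K\<close> for small \<open>\<delta>\<close> because
  \<open>N (N - 2) < (N - 1) ^ 2\<close> (lemma \<open>separating_scales\<close>).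

  For the uniform section estimate the frame of the hyperplane must be adapted to the distinguished
  coordinate. Lemma \<open>basis_lebesgue_unique\<close> permits this: Lebesgue measure on a subspace does
  not depend on the orthonormal basis through which it is defined.
\<close>

section \<open>Lebesgue measure of an orthonormal frame\<close>

lemma orthonormal_basis_of_facts:
  assumes "orthonormal_basis_of S B"
  shows "finite B" "card B = dim S" "independent B" "B \<subseteq> S" "0 \<notin> B"
proof -
  have po: "pairwise orthogonal B" and n: "\<And>b. b \<in> B \<Longrightarrow> norm b = 1" and s: "span B = S"
    using assms by (auto simp: orthonormal_basis_of_def)
  show z: "0 \<notin> B" using n by force
  show i: "independent B" using pairwise_orthogonal_independent[OF po z] .
  show "finite B" using independent_imp_finite[OF i] .
  show "card B = dim S" using dim_span_eq_card_independent[OF i] s by simp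
  show "B \<subseteq> S" using span_superset[of B] s by simp
qed

lemma norm_orthonormal_combination:
  assumes "pairwise orthogonal B" "\<forall>b\<in>B. norm b = 1" "finite B"
  shows "(norm (\<Sum>b\<in>B. c b *\<^sub>R b))\<^sup>2 = (\<Sum>b\<in>B. (c b)\<^sup>2)"
proof -
  have "(norm (\<Sum>b\<in>B. c b *\<^sub>R b))\<^sup>2 = (\<Sum>b\<in>B. (norm (c b *\<^sub>R b))\<^sup>2)"
    using assms by (intro norm_sum_Pythagorean) (auto simp: pairwise_def orthogonal_def)
  then show ?thesis using assms(2) by (simp add: power_mult_distrib)
qed

text \<open>
  The new vectors \<open>C\<close> form an orthonormal basis of the orthogonal complement of \<open>P\<close> inside
  \<open>S\<close>.
\<close>

lemma orthonormal_basis_extend: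
  fixes S :: "'a::euclidean_space set"
  assumes S: "subspace S" and P: "P \<subseteq> S" "pairwise orthogonal P" "\<forall>b\<in>P. norm b = 1" "finite P"
  obtains C where "orthonormal_basis_of S (P \<union> C)" "P \<inter> C = {}" "finite C"
    "orthonormal_basis_of (span C) C" "\<And>b c. b \<in> P \<Longrightarrow> c \<in> span C \<Longrightarrow> b \<bullet> c = 0"
proof -
  define T where "T = {x \<in> S. \<forall>b\<in>P. b \<bullet> x = 0}"
  have T: "subspace T" using S unfolding T_def subspace_def by (auto simp: inner_simps)
  obtain C where C: "orthonormal_basis_of T C" using orthonormal_basis_of_exists[OF T] by blast
  note f = orthonormal_basis_of_facts[OF C]
  have sC: "span C = T" using C by (simp add: orthonormal_basis_of_def)
  have CT: "\<And>b c. b \<in> P \<Longrightarrow> c \<in> span C \<Longrightarrow> b \<bullet> c = 0" using sC by (auto simp: T_def)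
  have disj: "P \<inter> C = {}" 
  proof -
    have "False" if "b \<in> P" "b \<in> C" for b
      using CT[OF that(1), of b] that f(4) sC P(3) by force
    then show ?thesis by blast
  qed
  have "S \<subseteq> span (P \<union> C)"
  proof
    fix x assume x: "x \<in> S"
    define p where "p = (\<Sum>b\<in>P. (b \<bullet> x) *\<^sub>R b)"
    have pP: "p \<in> span P" unfolding p_def by (intro span_sum span_scale span_base)
    then have pS: "p \<in> S" using span_minimal[OF P(1) S] by blast
    have "b \<bullet> p = b \<bullet> x" if b: "b \<in> P" for b
    proof -
      have "b \<bullet> p = (\<Sum>c\<in>P. (c \<bullet> x) * (b \<bullet> c))" by (simp add: p_def inner_sum_right)
      also have "\<dots> = (\<Sum>c\<in>P. if c = b then b \<bullet> x else 0)"
        using P(2,3) b by (intro sum.cong) (auto simp: pairwise_def orthogonal_def norm_eq_1)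
      finally show ?thesis using P(4) b by simp
    qed
    then have "x - p \<in> T" using x pS S by (auto simp: T_def inner_diff_right subspace_diff)
    then have "x - p \<in> span (P \<union> C)" using sC span_mono[of C "P \<union> C"] by blast
    moreover have "p \<in> span (P \<union> C)" using pP span_mono[of P "P \<union> C"] by blast
    ultimately show "x \<in> span (P \<union> C)" using span_add by fastforce
  qed
  moreover have "span (P \<union> C) \<subseteq> S"
    using span_minimal[of "P \<union> C" S] P(1) S f(4) by (auto simp: T_def)
  ultimately have "span (P \<union> C) = S" by blast
  moreover have "pairwise orthogonal (P \<union> C)"
    using P(2) C CT[OF _ span_base] unfolding pairwise_def orthonormal_basis_of_def orthogonal_def
    by (metis Un_iff inner_commute)
  ultimately have "orthonormal_basis_of S (P \<union> C)"
    using P(3) C by (auto simp: orthonormal_basis_of_def)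
  moreover have "orthonormal_basis_of (span C) C" using C sC by simp
  ultimately show ?thesis using that disj f(1) CT by blast
qed

definition basis_lebesgue :: "'a::euclidean_space set \<Rightarrow> 'a measure" where
  "basis_lebesgue B =
     distr (Pi\<^sub>M B (\<lambda>_. lborel :: real measure)) borel (\<lambda>c. \<Sum>b\<in>B. c b *\<^sub>R b)"

lemma sets_basis_lebesgue [simp, measurable_cong]: "sets (basis_lebesgue B) = sets borel"
  by (simp add: basis_lebesgue_def)

lemma space_basis_lebesgue [simp]: "space (basis_lebesgue B) = UNIV"
  by (simp add: basis_lebesgue_def)

lemma measurable_combination [measurable]:
  fixes B :: "'a::euclidean_space set"
  shows "(\<lambda>c. \<Sum>b\<in>B. c b *\<^sub>R b) \<in> borel_measurable (Pi\<^sub>M B (\<lambda>_. lborel :: real measure))"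
  by (intro borel_measurable_sum borel_measurable_scaleR) auto

lemma nn_integral_basis_lebesgue:
  assumes "f \<in> borel_measurable borel"
  shows "(\<integral>\<^sup>+x. f x \<partial>basis_lebesgue B) = (\<integral>\<^sup>+c. f (\<Sum>b\<in>B. c b *\<^sub>R b) \<partial>Pi\<^sub>M B (\<lambda>_. lborel))"
  using assms by (simp add: basis_lebesgue_def nn_integral_distr)

lemma combination_in_span: "(\<Sum>b\<in>B. c b *\<^sub>R b) \<in> span B"
  by (intro span_sum span_scale span_base)

lemma nn_integral_basis_lebesgue_cong:
  assumes [measurable]: "f \<in> borel_measurable borel" "g \<in> borel_measurable borel"
    and "\<And>x. x \<in> span B \<Longrightarrow> f x = g x"
  shows "(\<integral>\<^sup>+x. f x \<partial>basis_lebesgue B) = (\<integral>\<^sup>+x. g x \<partial>basis_lebesgue B)"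
  using assms(3) by (simp add: nn_integral_basis_lebesgue combination_in_span)

lemma nn_integral_basis_lebesgue_mono:
  assumes [measurable]: "f \<in> borel_measurable borel" "g \<in> borel_measurable borel"
    and "\<And>x. x \<in> span B \<Longrightarrow> f x \<le> g x"
  shows "(\<integral>\<^sup>+x. f x \<partial>basis_lebesgue B) \<le> (\<integral>\<^sup>+x. g x \<partial>basis_lebesgue B)"
  using assms(3) by (simp add: nn_integral_basis_lebesgue combination_in_span nn_integral_mono)

text \<open>
  A measure on a finite product is determined by its values on boxes, and each factor is invariant
  under translation and reflection.
\<close>

lemma PiM_lborel_affine:
  fixes s :: real
  assumes "finite B" "\<bar>s\<bar> = 1"
  shows "distr (Pi\<^sub>M B (\<lambda>_. lborel)) (Pi\<^sub>M B (\<lambda>_. lborel)) (\<lambda>c. \<lambda>b\<in>B. a b + s * c b)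
    = Pi\<^sub>M B (\<lambda>_. lborel)"
proof -
  interpret product_sigma_finite "\<lambda>_. lborel :: real measure" by standard
  interpret finite_product_sigma_finite "\<lambda>_. lborel :: real measure" B by standard fact
  have m: "(\<lambda>c. \<lambda>b\<in>B. a b + s * c b) \<in> measurable (Pi\<^sub>M B (\<lambda>_. lborel)) (Pi\<^sub>M B (\<lambda>_. lborel))"
    by (intro measurable_restrict) measurable
  show ?thesis
  proof (rule PiM_eqI)
    fix A :: "'a \<Rightarrow> real set" assume A: "\<And>i. i \<in> B \<Longrightarrow> A i \<in> sets lborel"
    have v: "(\<lambda>x. a i + s * x) -` A i \<in> sets lborel" if "i \<in> B" for i
      using measurable_sets_borel[of "\<lambda>x. a i + s * x" borel "A i"] A[OF that] by simp
    have e: "emeasure lborel ((\<lambda>x. a i + s * x) -` A i) = emeasure lborel (A i)" if "i \<in> B" for i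
    proof -
      have [measurable]: "A i \<in> sets borel" using A[OF that] by simp
      have "emeasure lborel (A i) = (\<integral>\<^sup>+x. indicator (A i) x \<partial>lborel)" by simp
      also have "\<dots> = (\<integral>\<^sup>+x. indicator (A i) (a i + s * x) \<partial>lborel)"
        using assms(2) by (subst nn_integral_real_affine[where c=s and t="a i"]) auto
      also have "\<dots> = (\<integral>\<^sup>+x. indicator ((\<lambda>x. a i + s * x) -` A i) x \<partial>lborel)"
        by (simp add: indicator_vimage)
      finally show ?thesis using v[OF that] by simp
    qed
    have "emeasure (distr (Pi\<^sub>M B (\<lambda>_. lborel)) (Pi\<^sub>M B (\<lambda>_. lborel)) (\<lambda>c. \<lambda>b\<in>B. a b + s * c b)) (Pi\<^sub>E B A)
       = emeasure (Pi\<^sub>M B (\<lambda>_. lborel)) (Pi\<^sub>E B (\<lambda>i. (\<lambda>x. a i + s * x) -` A i))"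
    proof (subst emeasure_distr[OF m])
      show "Pi\<^sub>E B A \<in> sets (Pi\<^sub>M B (\<lambda>_. lborel))" using A assms by (intro sets_PiM_I_finite) auto
    qed (rule arg_cong[where f="emeasure _"], auto simp: space_PiM PiE_iff extensional_def)
    also have "\<dots> = (\<Prod>i\<in>B. emeasure lborel (A i))"
      using v e by (subst measure_times) (auto cong: prod.cong)
    finally show "emeasure (distr (Pi\<^sub>M B (\<lambda>_. lborel)) (Pi\<^sub>M B (\<lambda>_. lborel)) (\<lambda>c. \<lambda>b\<in>B. a b + s * c b)) (Pi\<^sub>E B A)
       = (\<Prod>i\<in>B. emeasure lborel (A i))" .
  qed (use assms in auto)
qed

lemma nn_integral_basis_lebesgue_affine:
  fixes s :: real
  assumes B: "finite B" "\<bar>s\<bar> = 1" and v: "v \<in> span B" and [measurable]: "f \<in> borel_measurable borel"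
  shows "(\<integral>\<^sup>+x. f (v + s *\<^sub>R x) \<partial>basis_lebesgue B) = (\<integral>\<^sup>+x. f x \<partial>basis_lebesgue B)"
proof -
  obtain a where a: "v = (\<Sum>b\<in>B. a b *\<^sub>R b)" using v B(1) by (auto simp: span_finite)
  have m: "(\<lambda>c. \<lambda>b\<in>B. a b + s * c b) \<in> measurable (Pi\<^sub>M B (\<lambda>_. lborel)) (Pi\<^sub>M B (\<lambda>_. lborel))"
    by (intro measurable_restrict) measurable
  have "(\<integral>\<^sup>+x. f x \<partial>basis_lebesgue B) = (\<integral>\<^sup>+c. f (\<Sum>b\<in>B. c b *\<^sub>R b)
      \<partial>distr (Pi\<^sub>M B (\<lambda>_. lborel)) (Pi\<^sub>M B (\<lambda>_. lborel)) (\<lambda>c. \<lambda>b\<in>B. a b + s * c b))"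
    using PiM_lborel_affine[OF B] by (simp add: nn_integral_basis_lebesgue)
  also have "\<dots> = (\<integral>\<^sup>+c. f (\<Sum>b\<in>B. (a b + s * c b) *\<^sub>R b) \<partial>Pi\<^sub>M B (\<lambda>_. lborel))"
    by (subst nn_integral_distr[OF m]) auto
  also have "\<dots> = (\<integral>\<^sup>+x. f (v + s *\<^sub>R x) \<partial>basis_lebesgue B)"
    by (simp add: nn_integral_basis_lebesgue a scaleR_sum_right scaleR_add_left sum.distrib)
  finally show ?thesis by simp
qed

lemma emeasure_basis_lebesgue_cball:
  assumes B: "orthonormal_basis_of S B" and r: "r > 0"
  shows "emeasure (basis_lebesgue B) (cball 0 r) = ennreal (unit_ball_vol (card B) * r ^ card B)"
proof -
  have "emeasure (basis_lebesgue B) (cball 0 r) = emeasure (Pi\<^sub>M B (\<lambda>_. lborel))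
             ({f. sqrt (\<Sum>i\<in>B. (f i)\<^sup>2) \<le> r} \<inter> space (Pi\<^sub>M B (\<lambda>_. lborel)))"
    unfolding basis_lebesgue_def
  proof (subst emeasure_distr)
    have "norm (\<Sum>b\<in>B. c b *\<^sub>R b) = sqrt (\<Sum>i\<in>B. (c i)\<^sup>2)" for c
      using norm_orthonormal_combination[of B c] B orthonormal_basis_of_facts(1)[OF B]
      by (intro real_sqrt_unique[symmetric]) (auto simp: orthonormal_basis_of_def)
    then show "emeasure (Pi\<^sub>M B (\<lambda>_. lborel))
       ((\<lambda>c. \<Sum>b\<in>B. c b *\<^sub>R b) -` cball 0 r \<inter> space (Pi\<^sub>M B (\<lambda>_. lborel))) =
      emeasure (Pi\<^sub>M B (\<lambda>_. lborel))
       ({f. sqrt (\<Sum>i\<in>B. (f i)\<^sup>2) \<le> r} \<inter> space (Pi\<^sub>M B (\<lambda>_. lborel)))"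
      by (auto intro!: arg_cong[where f="emeasure _"])
  qed auto
  then show ?thesis using emeasure_cball_aux[of B r] r orthonormal_basis_of_facts(1)[OF B] by simp
qed

text \<open>
  Measurability of inner integrals, and Tonelli below, are pulled back along the coordinate map from
  the \<open>\<sigma>\<close>-finite product measures.
\<close>

lemma borel_measurable_nn_integral_basis_lebesgue:
  fixes f :: "'a::euclidean_space \<Rightarrow> 'a \<Rightarrow> ennreal"
  assumes "finite C" and [measurable]: "case_prod f \<in> borel_measurable (borel \<Otimes>\<^sub>M borel)"
  shows "(\<lambda>x. \<integral>\<^sup>+y. f x y \<partial>basis_lebesgue C) \<in> borel_measurable borel"
proof -
  interpret product_sigma_finite "\<lambda>_. lborel :: real measure" by standard
  interpret C: finite_product_sigma_finite "\<lambda>_. lborel :: real measure" C by standard fact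
  have "(\<lambda>x. \<integral>\<^sup>+y. f x y \<partial>basis_lebesgue C)
      = (\<lambda>x. \<integral>\<^sup>+c. f x (\<Sum>b\<in>C. c b *\<^sub>R b) \<partial>Pi\<^sub>M C (\<lambda>_. lborel))"
    by (intro ext nn_integral_basis_lebesgue) measurable
  also have "\<dots> \<in> borel_measurable borel"
    by (rule C.borel_measurable_nn_integral) measurable
  finally show ?thesis .
qed

lemma nn_integral_basis_lebesgue_swap:
  fixes f :: "'a::euclidean_space \<times> 'a \<Rightarrow> ennreal"
  assumes "finite B" "finite C" and [measurable]: "f \<in> borel_measurable borel"
  shows "(\<integral>\<^sup>+x. \<integral>\<^sup>+y. f (x, y) \<partial>basis_lebesgue C \<partial>basis_lebesgue B)
       = (\<integral>\<^sup>+y. \<integral>\<^sup>+x. f (x, y) \<partial>basis_lebesgue B \<partial>basis_lebesgue C)"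
proof -
  interpret product_sigma_finite "\<lambda>_. lborel :: real measure" by standard
  interpret B: finite_product_sigma_finite "\<lambda>_. lborel :: real measure" B by standard fact
  interpret C: finite_product_sigma_finite "\<lambda>_. lborel :: real measure" C by standard fact
  interpret pair_sigma_finite "Pi\<^sub>M B (\<lambda>_. lborel :: real measure)" "Pi\<^sub>M C (\<lambda>_. lborel :: real measure)" ..
  have [measurable]: "f \<in> borel_measurable (borel \<Otimes>\<^sub>M borel)" using assms(3) by (simp add: borel_prod)
  have 1: "(\<lambda>x. \<integral>\<^sup>+y. f (x, y) \<partial>basis_lebesgue C) = (\<lambda>x. \<integral>\<^sup>+c. f (x, \<Sum>b\<in>C. c b *\<^sub>R b) \<partial>Pi\<^sub>M C (\<lambda>_. lborel))"
    by (intro ext nn_integral_basis_lebesgue) measurable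
  have 2: "(\<lambda>y. \<integral>\<^sup>+x. f (x, y) \<partial>basis_lebesgue B) = (\<lambda>y. \<integral>\<^sup>+c. f (\<Sum>b\<in>B. c b *\<^sub>R b, y) \<partial>Pi\<^sub>M B (\<lambda>_. lborel))"
    by (intro ext nn_integral_basis_lebesgue) measurable
  have 3: "(\<integral>\<^sup>+x. \<integral>\<^sup>+y. f (x, y) \<partial>basis_lebesgue C \<partial>basis_lebesgue B)
    = (\<integral>\<^sup>+d. \<integral>\<^sup>+c. f (\<Sum>b\<in>B. d b *\<^sub>R b, \<Sum>b\<in>C. c b *\<^sub>R b) \<partial>Pi\<^sub>M C (\<lambda>_. lborel) \<partial>Pi\<^sub>M B (\<lambda>_. lborel))"
    unfolding 1 by (intro nn_integral_basis_lebesgue) measurable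
  have 4: "(\<integral>\<^sup>+y. \<integral>\<^sup>+x. f (x, y) \<partial>basis_lebesgue B \<partial>basis_lebesgue C)
    = (\<integral>\<^sup>+c. \<integral>\<^sup>+d. f (\<Sum>b\<in>B. d b *\<^sub>R b, \<Sum>b\<in>C. c b *\<^sub>R b) \<partial>Pi\<^sub>M B (\<lambda>_. lborel) \<partial>Pi\<^sub>M C (\<lambda>_. lborel))"
    unfolding 2 by (intro nn_integral_basis_lebesgue) measurable
  show ?thesis unfolding 3 4 by (rule Fubini'[symmetric]) measurable
qed

text \<open>
  This is the uniqueness argument for Haar measure. With \<open>U\<close> the unit ball, the double integral of
  \<open>indicator A x * indicator U (y - x)\<close> is the first measure of \<open>A\<close>
  times the second one of \<open>U\<close> when the integral over \<open>y\<close> is done first, by translation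
  invariance. After the reflection \<open>x \<mapsto> y - x\<close> the roles are exchanged. Both measures give
  \<open>U\<close> the same volume \<open>V\<close>, since the volume of a ball depends only on the number of
  coordinates.
\<close>

lemma basis_lebesgue_unique:
  fixes S :: "'a::euclidean_space set"
  assumes B: "orthonormal_basis_of S B" and C: "orthonormal_basis_of S C"
  shows "basis_lebesgue B = basis_lebesgue C"
proof (rule measure_eqI)
  fix A :: "'a set" assume "A \<in> sets (basis_lebesgue B)"
  then have [measurable]: "A \<in> sets borel" by simp
  note fB = orthonormal_basis_of_facts[OF B] and fC = orthonormal_basis_of_facts[OF C]
  have sp: "span B = S" "span C = S" using B C by (auto simp: orthonormal_basis_of_def)
  define U :: "'a set" where "U = cball 0 1"
  have [measurable]: "U \<in> sets borel" by (simp add: U_def)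
  let ?MB = "basis_lebesgue B" and ?MC = "basis_lebesgue C"
  define V where "V = ennreal (unit_ball_vol (dim S))"
  have V: "emeasure ?MB U = V" "emeasure ?MC U = V"
    using emeasure_basis_lebesgue_cball[OF B, of 1] emeasure_basis_lebesgue_cball[OF C, of 1] fB(2) fC(2)
    by (simp_all add: U_def V_def)
  have V0: "V \<noteq> 0" "V \<noteq> \<infinity>" using unit_ball_vol_pos[of "dim S"] by (auto simp: V_def ennreal_eq_0_iff not_le)
  have sS: "subspace S" using sp(1) subspace_span[of B] by simp
  have "emeasure ?MB A * V = (\<integral>\<^sup>+x. indicator A x * V \<partial>?MB)"
    by (simp add: nn_integral_multc)
  also have "\<dots> = (\<integral>\<^sup>+x. indicator A x * (\<integral>\<^sup>+y. indicator U (y - x) \<partial>?MC) \<partial>?MB)"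
  proof (rule nn_integral_basis_lebesgue_cong)
    fix x assume x: "x \<in> span B"
    have "(\<integral>\<^sup>+y. indicator U (y - x) \<partial>?MC) = (\<integral>\<^sup>+y. indicator U (-x + 1 *\<^sub>R y) \<partial>?MC)" by simp
    also have "\<dots> = V"
      using x sp sS by (subst nn_integral_basis_lebesgue_affine[OF fC(1), where f="indicator U"]) (auto simp: V subspace_neg)
    finally show "indicator A x * V = indicator A x * (\<integral>\<^sup>+y. indicator U (y - x) \<partial>?MC)" by simp
  next
    show "(\<lambda>x. indicator A x * (\<integral>\<^sup>+y. indicator U (y - x) \<partial>?MC)) \<in> borel_measurable borel"
      by (rule borel_measurable_times_ennreal, measurable, rule borel_measurable_nn_integral_basis_lebesgue[OF fC(1)]) measurable
  qed measurable
  also have "\<dots> = (\<integral>\<^sup>+x. \<integral>\<^sup>+y. (indicator A x * indicator U (y - x)) \<partial>?MC \<partial>?MB)"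
    by (intro nn_integral_cong nn_integral_cmult[symmetric]) measurable
  also have "\<dots> = (\<integral>\<^sup>+y. \<integral>\<^sup>+x. (indicator A x * indicator U (y - x)) \<partial>?MB \<partial>?MC)"
    using nn_integral_basis_lebesgue_swap[OF fB(1) fC(1), of "\<lambda>(x,y). indicator A x * indicator U (y - x)"]
    by (simp add: borel_prod[symmetric])
  also have "\<dots> = (\<integral>\<^sup>+y. \<integral>\<^sup>+x. (indicator A (y - x) * indicator U x) \<partial>?MB \<partial>?MC)"
    (is "(\<integral>\<^sup>+y. ?f y \<partial>?MC) = (\<integral>\<^sup>+y. ?g y \<partial>?MC)")
  proof (rule nn_integral_basis_lebesgue_cong)
    fix y assume y: "y \<in> span C"
    show "?f y = ?g y"
      using y sp nn_integral_basis_lebesgue_affine[OF fB(1), of "-1" y "\<lambda>x. indicator A x * indicator U (y - x)"]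
      by simp
  next
    show "?f \<in> borel_measurable borel" "?g \<in> borel_measurable borel"
      by (rule borel_measurable_nn_integral_basis_lebesgue[OF fB(1)], measurable)+
  qed
  also have "\<dots> = (\<integral>\<^sup>+x. \<integral>\<^sup>+y. (indicator A (y - x) * indicator U x) \<partial>?MC \<partial>?MB)"
    using nn_integral_basis_lebesgue_swap[OF fB(1) fC(1), of "\<lambda>(x,y). indicator A (y - x) * indicator U x"]
    by (simp add: borel_prod[symmetric])
  also have "\<dots> = (\<integral>\<^sup>+x. (\<integral>\<^sup>+y. indicator A (y - x) \<partial>?MC) * indicator U x \<partial>?MB)"
    by (intro nn_integral_cong nn_integral_multc) measurable
  also have "\<dots> = (\<integral>\<^sup>+x. emeasure ?MC A * indicator U x \<partial>?MB)"
  proof (rule nn_integral_basis_lebesgue_cong)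
    fix x assume x: "x \<in> span B"
    have "(\<integral>\<^sup>+y. indicator A (y - x) \<partial>?MC) = (\<integral>\<^sup>+y. indicator A (-x + 1 *\<^sub>R y) \<partial>?MC)" by simp
    also have "\<dots> = emeasure ?MC A"
      using x sp sS by (subst nn_integral_basis_lebesgue_affine[OF fC(1), where f="indicator A"]) (auto simp: subspace_neg)
    finally show "(\<integral>\<^sup>+y. indicator A (y - x) \<partial>?MC) * indicator U x = emeasure ?MC A * indicator U x" by simp
  next
    show "(\<lambda>x. (\<integral>\<^sup>+y. indicator A (y - x) \<partial>?MC) * indicator U x) \<in> borel_measurable borel"
      by (rule borel_measurable_times_ennreal, rule borel_measurable_nn_integral_basis_lebesgue[OF fC(1)]) measurable
  qed measurable
  also have "\<dots> = emeasure ?MC A * V" by (simp add: nn_integral_cmult V)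
  finally show "emeasure ?MB A = emeasure ?MC A"
    using V0 by (simp add: mult.commute[of _ V] ennreal_mult_cancel_left)
qed simp

lemma nn_integral_basis_lebesgue_Un:
  fixes f :: "'a::euclidean_space \<Rightarrow> ennreal"
  assumes "finite B" "finite C" "B \<inter> C = {}" and [measurable]: "f \<in> borel_measurable borel"
  shows "(\<integral>\<^sup>+x. f x \<partial>basis_lebesgue (B \<union> C))
       = (\<integral>\<^sup>+x. \<integral>\<^sup>+y. f (x + y) \<partial>basis_lebesgue C \<partial>basis_lebesgue B)"
proof -
  interpret product_sigma_finite "\<lambda>_. lborel :: real measure" by standard
  interpret B: finite_product_sigma_finite "\<lambda>_. lborel :: real measure" B by standard fact
  interpret C: finite_product_sigma_finite "\<lambda>_. lborel :: real measure" C by standard fact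
  have 1: "(\<lambda>x. \<integral>\<^sup>+y. f (x + y) \<partial>basis_lebesgue C) = (\<lambda>x. \<integral>\<^sup>+c. f (x + (\<Sum>b\<in>C. c b *\<^sub>R b)) \<partial>Pi\<^sub>M C (\<lambda>_. lborel))"
    by (intro ext nn_integral_basis_lebesgue) measurable
  have "(\<integral>\<^sup>+x. f x \<partial>basis_lebesgue (B \<union> C)) = (\<integral>\<^sup>+d. \<integral>\<^sup>+c. f (\<Sum>b\<in>B\<union>C. merge B C (d,c) b *\<^sub>R b) \<partial>Pi\<^sub>M C (\<lambda>_. lborel) \<partial>Pi\<^sub>M B (\<lambda>_. lborel))"
    using assms by (subst nn_integral_basis_lebesgue) (auto intro!: product_nn_integral_fold)
  also have "(\<lambda>d c. \<Sum>b\<in>B\<union>C. merge B C (d,c) b *\<^sub>R b) = (\<lambda>d c. (\<Sum>b\<in>B. d b *\<^sub>R b) + (\<Sum>b\<in>C. c b *\<^sub>R b))"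
    using assms by (intro ext, subst sum.union_disjoint) (auto intro!: arg_cong2[where f="(+)"] sum.cong simp: merge_def)
  finally have 2: "(\<integral>\<^sup>+x. f x \<partial>basis_lebesgue (B \<union> C)) = (\<integral>\<^sup>+d. \<integral>\<^sup>+c. f ((\<Sum>b\<in>B. d b *\<^sub>R b) + (\<Sum>b\<in>C. c b *\<^sub>R b)) \<partial>Pi\<^sub>M C (\<lambda>_. lborel) \<partial>Pi\<^sub>M B (\<lambda>_. lborel))"
    by meson
  also have "\<dots> = (\<integral>\<^sup>+x. \<integral>\<^sup>+y. f (x + y) \<partial>basis_lebesgue C \<partial>basis_lebesgue B)"
    unfolding 1 by (intro nn_integral_basis_lebesgue[symmetric]) measurable
  finally show ?thesis .
qed

lemma subspace_lebesgue_eq: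
  assumes "orthonormal_basis_of S B"
  shows "subspace_lebesgue S = basis_lebesgue B"
  using basis_lebesgue_unique[OF someI[of "orthonormal_basis_of S", OF assms] assms]
  by (simp add: subspace_lebesgue_def Let_def basis_lebesgue_def)

lemma orthonormal_basis_of_Basis: "orthonormal_basis_of UNIV (Basis :: 'a::euclidean_space set)"
  by (auto simp: orthonormal_basis_of_def pairwise_def orthogonal_def inner_Basis)

lemma lborel_eq_basis_lebesgue:
  fixes B :: "'a::euclidean_space set"
  assumes "orthonormal_basis_of UNIV B"
  shows "lborel = basis_lebesgue B"
proof -
  have "lborel = basis_lebesgue (Basis :: 'a set)"
    unfolding basis_lebesgue_def by (rule lborel_eq)
  then show ?thesis using basis_lebesgue_unique[OF orthonormal_basis_of_Basis assms] by (rule trans)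
qed

section \<open>Shells and weighted integrals over the ball\<close>

lemma power_diff_le_mult:
  fixes c d :: real
  assumes "0 \<le> c" "c \<le> d" "d \<le> 1"
  shows "d ^ k - c ^ k \<le> k * (d - c)"
proof (induction k)
  case (Suc k)
  have "d ^ Suc k - c ^ Suc k = d * (d ^ k - c ^ k) + c ^ k * (d - c)" by (simp add: algebra_simps)
  also have "\<dots> \<le> 1 * (d ^ k - c ^ k) + 1 * (d - c)"
    using assms by (intro add_mono mult_right_mono) (auto intro: power_mono power_le_one)
  also have "\<dots> \<le> Suc k * (d - c)" using Suc by (simp add: algebra_simps)
  finally show ?case .
qed simp

lemma power_diff_ge_mult:
  fixes c d :: real
  assumes "0 \<le> c" "c \<le> d" "k \<ge> 1"
  shows "c ^ (k - 1) * (d - c) \<le> d ^ k - c ^ k"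
proof -
  have k: "x ^ k = x ^ (k - 1) * x" for x :: real using assms(3) by (metis One_nat_def Suc_pred less_le_trans mult.commute power_Suc zero_less_one)
  have "c ^ (k - 1) * d \<le> d ^ (k - 1) * d"
    using assms by (intro mult_right_mono power_mono) auto
  then show ?thesis by (simp add: k[of c] k[of d] algebra_simps)
qed

text \<open>
  In an even dimension \<open>2 * k\<close> the volume of a ball is a polynomial in its squared radius, so
  shells are best described by bounds on the squared norm. The two estimates after this lemma
  linearise the difference of powers: a shell has measure comparable to its width.
\<close>

lemma emeasure_basis_lebesgue_shell:
  assumes B: "orthonormal_basis_of S B" "card B = 2 * k" and c: "0 < c" "c \<le> d"
  shows "emeasure (basis_lebesgue B) {x. c < (norm x)\<^sup>2 \<and> (norm x)\<^sup>2 \<le> d}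
    = ennreal (unit_ball_vol (2 * k) * (d ^ k - c ^ k))"
proof -
  have n: "(norm x)\<^sup>2 \<le> e \<longleftrightarrow> x \<in> cball 0 (sqrt e)" if "e > 0" for x :: 'a and e
    using that by (simp add: real_le_rsqrt sqrt_ge_absD abs_le_square_iff[symmetric]) (metis abs_of_nonneg norm_ge_zero real_le_rsqrt sqrt_ge_absD)
  have s: "sqrt e ^ (2 * k) = e ^ k" if "e > 0" for e using that by (simp add: power_mult)
  have "{x. c < (norm x)\<^sup>2 \<and> (norm x)\<^sup>2 \<le> d} = cball 0 (sqrt d) - cball (0::'a) (sqrt c)"
    using n[of c] n[of d] c by (auto simp: not_le[symmetric] simp del: mem_cball)
  also have "emeasure (basis_lebesgue B) \<dots>
      = emeasure (basis_lebesgue B) (cball 0 (sqrt d)) - emeasure (basis_lebesgue B) (cball 0 (sqrt c))"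
    using c emeasure_basis_lebesgue_cball[OF B(1), of "sqrt c"]
    by (intro emeasure_Diff subset_cball real_sqrt_le_mono) auto
  also have "\<dots> = ennreal (unit_ball_vol (2 * k) * (d ^ k - c ^ k))"
    using c emeasure_basis_lebesgue_cball[OF B(1), of "sqrt c"] emeasure_basis_lebesgue_cball[OF B(1), of "sqrt d"]
    by (simp add: B(2) s ennreal_minus right_diff_distrib)
  finally show ?thesis .
qed

lemma emeasure_basis_lebesgue_shell_le:
  assumes B: "orthonormal_basis_of S B" "card B = 2 * k" "k \<ge> 1" and d: "d \<le> 1"
  shows "emeasure (basis_lebesgue B) {x. c < (norm x)\<^sup>2 \<and> (norm x)\<^sup>2 \<le> d}
    \<le> ennreal (unit_ball_vol (2 * k) * k * (d - c))"
proof (cases "d \<le> c \<or> d < 0")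
  case True
  then have "{x::'a. c < (norm x)\<^sup>2 \<and> (norm x)\<^sup>2 \<le> d} = {}"
    by (auto simp: not_le) (smt (verit) zero_le_power2)
  then show ?thesis by (metis emeasure_empty zero_le)
next
  case False
  then have cd: "c < d" "0 \<le> d" by auto
  show ?thesis
  proof (cases "c > 0")
    case True
    then show ?thesis using emeasure_basis_lebesgue_shell[OF B(1,2) True, of d] cd d power_diff_le_mult[of c d k]
      by (auto simp: mult.assoc intro!: ennreal_leI mult_left_mono)
  next
    case False
    \<comment> \<open>a positive squared radius, also in the degenerate case \<open>d = 0\<close>\<close>
    define e where "e = min 1 (d - c)"
    have e: "0 < e" "d \<le> e" "e \<le> 1" "e \<le> d - c" using cd d False by (auto simp: e_def)
    have "emeasure (basis_lebesgue B) {x. c < (norm x)\<^sup>2 \<and> (norm x)\<^sup>2 \<le> d}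
      \<le> emeasure (basis_lebesgue B) (cball 0 (sqrt e))"
      using e by (intro emeasure_mono) (auto intro!: real_le_rsqrt)
    also have "\<dots> = ennreal (unit_ball_vol (2 * k) * e ^ k)"
      using e by (simp add: emeasure_basis_lebesgue_cball[OF B(1)] B(2) power_mult)
    also have "\<dots> \<le> ennreal (unit_ball_vol (2 * k) * k * (d - c))"
    proof (intro ennreal_leI)
      have "e ^ k \<le> e ^ 1" using e B(3) by (intro power_decreasing) auto
      also have "\<dots> \<le> 1 * (d - c)" using e by simp
      also have "\<dots> \<le> k * (d - c)" using B(3) cd by (intro mult_right_mono) auto
      finally show "unit_ball_vol (2 * k) * e ^ k \<le> unit_ball_vol (2 * k) * k * (d - c)"
        by (simp add: mult.assoc mult_left_mono)
    qed
    finally show ?thesis .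
  qed
qed

lemma emeasure_basis_lebesgue_shell_ge:
  assumes B: "orthonormal_basis_of S B" "card B = 2 * k" "k \<ge> 1" and c: "0 < c" "c \<le> d"
  shows "ennreal (unit_ball_vol (2 * k) * c ^ (k - 1) * (d - c))
    \<le> emeasure (basis_lebesgue B) {x. c < (norm x)\<^sup>2 \<and> (norm x)\<^sup>2 \<le> d}"
  using emeasure_basis_lebesgue_shell[OF B(1,2) c] power_diff_ge_mult[of c d k] c B(3)
  by (auto simp: mult.assoc intro!: ennreal_leI mult_left_mono)

text \<open>
  Dyadic layers: where \<open>D x\<close> lies between \<open>2 ^ j * \<delta>\<close> and
  \<open>2 ^ (j + 1) * \<delta>\<close> the integrand is at most \<open>(2 ^ j * \<delta>) powr (- N)\<close>, and the
  layer has measure at most \<open>C * (2 ^ (j + 1) * \<delta>) ^ k\<close>. Since \<open>k < N\<close> the products are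
  dominated by a geometric series of ratio \<open>1/2\<close>, so that the innermost layer gives the order of
  magnitude.
\<close>

lemma nn_integral_inverse_power_le:
  fixes D :: "'a::topological_space \<Rightarrow> real"
  assumes sets [measurable_cong]: "sets M = sets borel" and [measurable]: "A \<in> sets borel" "D \<in> borel_measurable borel"
    and \<delta>: "0 < \<delta>" "\<And>x. x \<in> A \<Longrightarrow> \<delta> \<le> D x" and kN: "k < N" and C: "0 \<le> C"
    and layer: "\<And>t. t > 0 \<Longrightarrow> emeasure M {x\<in>A. D x < t} \<le> ennreal (C * t ^ k)"
  shows "(\<integral>\<^sup>+x\<in>A. ennreal (1 / D x ^ N) \<partial>M) \<le> ennreal (C * 2 ^ (k + 1) / \<delta> ^ (N - k))"
proof -
  define E where "E j = {x\<in>A. D x < 2 ^ (j + 1) * \<delta>}" for j :: nat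
  have [measurable]: "E j \<in> sets borel" for j unfolding E_def by measurable
  have "(\<integral>\<^sup>+x\<in>A. ennreal (1 / D x ^ N) \<partial>M)
      \<le> (\<integral>\<^sup>+x. (\<Sum>j. ennreal (1 / (2 ^ j * \<delta>) ^ N) * indicator (E j) x) \<partial>M)"
  proof (rule nn_integral_mono)
    fix x
    show "ennreal (1 / D x ^ N) * indicator A x \<le> (\<Sum>j. ennreal (1 / (2 ^ j * \<delta>) ^ N) * indicator (E j) x)"
    proof (cases "x \<in> A")
      case True
      obtain j where j: "D x < 2 ^ j * \<delta>"
        using real_arch_pow[of 2 "D x / \<delta>"] \<delta>(1) by (auto simp: field_simps)
      \<comment> \<open>the dyadic layer that contains the point\<close>
      define m where "m = (LEAST j. D x < 2 ^ (j + 1) * \<delta>)"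
      have "D x < 2 ^ (j + 1) * \<delta>" using j \<delta> by (smt (verit) mult_right_mono power_increasing le_add1 one_le_numeral)
      then have m: "D x < 2 ^ (m + 1) * \<delta>" unfolding m_def by (rule LeastI)
      have "2 ^ m * \<delta> \<le> D x"
      proof (cases m)
        case 0 then show ?thesis using \<delta>(2)[OF True] by simp
      next
        case (Suc i)
        then have "i < (LEAST j. D x < 2 ^ (j + 1) * \<delta>)" by (simp add: m_def)
        from not_less_Least[OF this] show ?thesis by (simp add: Suc)
      qed
      then have "1 / D x ^ N \<le> 1 / (2 ^ m * \<delta>) ^ N"
        using \<delta> by (intro divide_left_mono power_mono mult_pos_pos zero_less_power) (auto intro: less_le_trans[of 0 "2 ^ m * \<delta>"])
      then have "ennreal (1 / D x ^ N) * indicator A x \<le> ennreal (1 / (2 ^ m * \<delta>) ^ N) * indicator (E m) x"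
        using True m by (auto simp: E_def intro!: ennreal_leI)
      also have "\<dots> \<le> (\<Sum>j. ennreal (1 / (2 ^ j * \<delta>) ^ N) * indicator (E j) x)"
        using sum_le_suminf[of "\<lambda>j. ennreal (1 / (2 ^ j * \<delta>) ^ N) * indicator (E j) x" "{m}"]
        by (simp del: sum_mult_indicator)
      finally show ?thesis .
    qed simp
  qed
  also have "\<dots> = (\<Sum>j. ennreal (1 / (2 ^ j * \<delta>) ^ N) * emeasure M (E j))"
    by (subst nn_integral_suminf) (auto simp: nn_integral_cmult_indicator)
  also have "\<dots> \<le> (\<Sum>j. ennreal (C * 2 ^ k / \<delta> ^ (N - k) * (1 / 2) ^ j))"
  proof (rule suminf_le)
    fix j
    have N: "N = k + (N - k)" using kN by simp
    have "ennreal (1 / (2 ^ j * \<delta>) ^ N) * emeasure M (E j)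
        \<le> ennreal (1 / (2 ^ j * \<delta>) ^ N) * ennreal (C * (2 ^ (j + 1) * \<delta>) ^ k)"
      unfolding E_def using \<delta>(1) by (intro mult_left_mono layer) auto
    also have "\<dots> = ennreal (1 / (2 ^ j * \<delta>) ^ N * (C * (2 ^ (j + 1) * \<delta>) ^ k))"
      using \<delta>(1) C by (intro ennreal_mult[symmetric]) auto
    also have "1 / (2 ^ j * \<delta>) ^ N * (C * (2 ^ (j + 1) * \<delta>) ^ k) = C * 2 ^ k / \<delta> ^ (N - k) * (1 / 2 ^ j) ^ (N - k)"
    proof -
      have "(2 ^ j * \<delta>) ^ N = (2 ^ j * \<delta>) ^ k * (2 ^ j * \<delta>) ^ (N - k)" using N by (metis power_add)
      moreover have "(2 ^ (j + 1) * \<delta>) ^ k = 2 ^ k * (2 ^ j * \<delta>) ^ k" by (simp add: power_mult_distrib)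
      ultimately show ?thesis using \<delta>(1) by (simp add: power_mult_distrib power_divide field_simps)
    qed
    also have "ennreal \<dots> \<le> ennreal (C * 2 ^ k / \<delta> ^ (N - k) * (1 / 2) ^ j)"
    proof (intro ennreal_leI mult_left_mono)
      have "(1 / 2 ^ j :: real) ^ (N - k) \<le> (1 / 2 ^ j) ^ 1" using kN by (intro power_decreasing) auto
      then show "(1 / 2 ^ j :: real) ^ (N - k) \<le> (1 / 2) ^ j" by (simp add: power_divide)
    qed (use C \<delta>(1) in auto)
    finally show "ennreal (1 / (2 ^ j * \<delta>) ^ N) * emeasure M (E j) \<le> ennreal (C * 2 ^ k / \<delta> ^ (N - k) * (1 / 2) ^ j)" .
  qed auto
  also have "\<dots> = ennreal (C * 2 ^ k / \<delta> ^ (N - k) * 2)"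
    using C \<delta>(1) sums_mult[OF geometric_sums[of "1/2 :: real"], of "C * 2 ^ k / \<delta> ^ (N - k)"]
    by (intro suminf_ennreal_eq) auto
  also have "\<dots> = ennreal (C * 2 ^ (k + 1) / \<delta> ^ (N - k))" by (simp add: mult_ac)
  finally show ?thesis .
qed

lemma nn_integral_inverse_power_ge:
  fixes D :: "'a::topological_space \<Rightarrow> real"
  assumes sets [measurable_cong]: "sets M = sets borel" and [measurable]: "A \<in> sets borel"
    and "A \<subseteq> K" "\<And>x. x \<in> A \<Longrightarrow> 0 < D x \<and> D x \<le> b" 
  shows "ennreal (1 / b ^ N) * emeasure M A \<le> (\<integral>\<^sup>+x\<in>K. ennreal (1 / D x ^ N) \<partial>M)"
proof -
  have "ennreal (1 / b ^ N) * emeasure M A = (\<integral>\<^sup>+x. ennreal (1 / b ^ N) * indicator A x \<partial>M)"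
    by (rule nn_integral_cmult_indicator[symmetric]) measurable
  also have "\<dots> \<le> (\<integral>\<^sup>+x\<in>K. ennreal (1 / D x ^ N) \<partial>M)"
  proof (rule nn_integral_mono)
    fix x
    show "ennreal (1 / b ^ N) * indicator A x \<le> ennreal (1 / D x ^ N) * indicator K x"
    proof (cases "x \<in> A")
      case True
      then have D: "0 < D x" "D x \<le> b" using assms(4) by auto
      then have "1 / b ^ N \<le> 1 / D x ^ N" by (intro divide_left_mono power_mono) auto
      moreover have "x \<in> K" using True assms(3) by blast
      ultimately show ?thesis using True by (simp add: ennreal_leI)
    qed simp
  qed
  finally show ?thesis .
qed

text \<open>
  Boundedness away from the unit sphere makes the Bochner integrals in the definition of hyperbolic
  volume agree with nonnegative integrals, for which no integrability has to be carried along.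
\<close>

lemma set_lebesgue_integral_inverse_power:
  fixes A :: "'a::euclidean_space set"
  assumes sets [measurable_cong]: "sets M = sets borel" and fin: "emeasure M (cball 0 1) < \<infinity>"
    and [measurable]: "A \<in> sets borel" and \<delta>: "0 < \<delta>" "\<And>x. x \<in> A \<Longrightarrow> \<delta> \<le> 1 - (norm x)\<^sup>2"
  shows "(\<integral>\<^sup>+x\<in>A. ennreal (1 / (1 - (norm x)\<^sup>2) ^ N) \<partial>M)
       = ennreal (LINT x:A|M. 1 / (1 - (norm x)\<^sup>2) ^ N)"
    and "0 \<le> (LINT x:A|M. 1 / (1 - (norm x)\<^sup>2) ^ N)"
proof -
  let ?f = "\<lambda>x. indicator A x *\<^sub>R (1 / (1 - (norm x)\<^sup>2) ^ N)"
  have nn: "0 \<le> ?f x" for x using \<delta>(2)[of x] \<delta>(1) by (auto simp: indicator_def)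
  have "(\<integral>\<^sup>+x. ennreal (?f x) \<partial>M) \<le> (\<integral>\<^sup>+x. ennreal (1 / \<delta> ^ N) * indicator (cball 0 1) x \<partial>M)"
  proof (rule nn_integral_mono)
    fix x
    show "ennreal (?f x) \<le> ennreal (1 / \<delta> ^ N) * indicator (cball 0 1) x"
    proof (cases "x \<in> A")
      case True
      have "(norm x)\<^sup>2 \<le> 1" using \<delta>(2)[OF True] \<delta>(1) by linarith
      then have "norm x \<le> 1" by (simp add: abs_square_le_1)
      moreover have "1 / (1 - (norm x)\<^sup>2) ^ N \<le> 1 / \<delta> ^ N"
        using \<delta>(2)[OF True] \<delta>(1) by (intro divide_left_mono power_mono) auto
      ultimately show ?thesis using True by (auto intro: ennreal_leI)
    qed simp
  qed
  also have "\<dots> = ennreal (1 / \<delta> ^ N) * emeasure M (cball 0 1)"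
    by (rule nn_integral_cmult_indicator) measurable
  also have "\<dots> < \<infinity>" using fin by (simp add: ennreal_mult_less_top)
  finally have "integrable M ?f" using nn by (intro integrableI_nonneg) auto
  then have "(\<integral>\<^sup>+x. ennreal (?f x) \<partial>M) = ennreal (LINT x|M. ?f x)"
    using nn by (intro nn_integral_eq_integral) auto
  moreover have "(\<integral>\<^sup>+x. ennreal (?f x) \<partial>M) = (\<integral>\<^sup>+x\<in>A. ennreal (1 / (1 - (norm x)\<^sup>2) ^ N) \<partial>M)"
    by (intro nn_integral_cong) (auto simp: indicator_def)
  ultimately show "(\<integral>\<^sup>+x\<in>A. ennreal (1 / (1 - (norm x)\<^sup>2) ^ N) \<partial>M)
       = ennreal (LINT x:A|M. 1 / (1 - (norm x)\<^sup>2) ^ N)"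
    by (simp add: set_lebesgue_integral_def)
  show "0 \<le> (LINT x:A|M. 1 / (1 - (norm x)\<^sup>2) ^ N)"
    unfolding set_lebesgue_integral_def using nn by (rule Bochner_Integration.integral_nonneg)
qed

section \<open>Hermitian geometry and circular bodies\<close>

text \<open>
  The real inner products with \<open>w\<close> and \<open>\<i> *s w\<close> are the real and imaginary parts of
  this form, which links complex hyperplanes to real orthogonality.
\<close>

definition herm :: "complex ^ 'n \<Rightarrow> complex ^ 'n \<Rightarrow> complex" where
  "herm x y = (\<Sum>k\<in>UNIV. x $ k * cnj (y $ k))"

lemma herm_add_left: "herm (x + y) z = herm x z + herm y z"
  by (simp add: herm_def algebra_simps sum.distrib)

lemma herm_diff_right: "herm x (y - z) = herm x y - herm x z"
  by (simp add: herm_def algebra_simps sum_subtractf)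

lemma herm_scale_left: "herm (c *s x) y = c * herm x y"
  by (simp add: herm_def sum_distrib_left mult.assoc)

lemma herm_scale_right: "herm x (c *s y) = cnj c * herm x y"
  by (simp add: herm_def sum_distrib_left mult_ac)

lemma scaleR_eq_scale: "r *\<^sub>R (x :: complex ^ 'n) = of_real r *s x"
  unfolding vec_eq_iff vector_scaleR_component vector_smult_component
  by (simp add: scaleR_conv_of_real)

lemma herm_commute: "herm y x = cnj (herm x y)"
  by (simp add: herm_def mult.commute)

lemma herm_axis_right: "herm x (axis i 1) = x $ i"
proof -
  have "herm x (axis i 1) = (\<Sum>k\<in>UNIV. if k = i then x $ i else 0)"
    unfolding herm_def by (intro sum.cong) (auto simp: axis_def)
  then show ?thesis by simp
qed

lemma inner_eq_Re_herm: "x \<bullet> y = Re (herm x y)"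
  by (simp add: herm_def inner_vec_def inner_complex_def)

lemma inner_i_eq_Im_herm: "x \<bullet> (\<i> *s y) = Im (herm x y)"
  by (simp add: inner_eq_Re_herm herm_scale_right)

lemma herm_self: "herm x x = of_real ((norm x)\<^sup>2)"
proof (rule complex_eqI)
  show "Re (herm x x) = Re (of_real ((norm x)\<^sup>2))"
    by (simp add: inner_eq_Re_herm[symmetric] power2_norm_eq_inner)
  show "Im (herm x x) = Im (of_real ((norm x)\<^sup>2))"
    by (simp add: herm_def mult.commute)
qed

lemma norm_scale: "norm (c *s (x :: complex ^ 'n)) = cmod c * norm x"
  by (simp add: norm_vec_def norm_mult L2_set_right_distrib)

lemma scale_add_left: "(c + d) *s (x :: complex ^ 'n) = c *s x + d *s x"
  by (simp add: vec_eq_iff algebra_simps)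

text \<open>
  Multiplying \<open>x\<close> by a phase makes the form real, where the real Cauchy-Schwarz inequality applies.
\<close>

lemma cmod_herm_le: "cmod (herm x y) \<le> norm x * norm y"
proof (cases "herm x y = 0")
  case False
  define c where "c = cnj (herm x y) / cmod (herm x y)"
  have c: "cmod c = 1" using False by (simp add: c_def norm_divide)
  have "c * herm x y = (herm x y * cnj (herm x y)) / cmod (herm x y)" by (simp add: c_def)
  also have "\<dots> = of_real (cmod (herm x y))"
    unfolding complex_norm_square[symmetric] using False by (simp add: power2_eq_square)
  finally have "(c *s x) \<bullet> y = cmod (herm x y)" by (simp add: inner_eq_Re_herm herm_scale_left)
  then have "cmod (herm x y) \<le> norm (c *s x) * norm y" by (metis norm_cauchy_schwarz)
  then show ?thesis by (simp add: norm_scale c)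
qed simp

lemma herm_eq_0_iff_line_frame: "herm z w = 0 \<longleftrightarrow> w \<bullet> z = 0 \<and> (\<i> *s w) \<bullet> z = 0"
  by (simp add: inner_commute[of w] inner_commute[of "\<i> *s w"] complex_eq_iff
      flip: inner_eq_Re_herm inner_i_eq_Im_herm)

lemma complex_hyperplane_eq: "complex_hyperplane \<xi> = {z. herm z \<xi> = 0}"
  by (simp add: complex_hyperplane_def herm_def)

lemma subspace_complex_hyperplane: "subspace (complex_hyperplane \<xi>)"
  by (auto simp: subspace_def complex_hyperplane_eq herm_add_left scaleR_eq_scale herm_scale_left)
     (simp add: herm_def)

lemma scale_in_complex_hyperplane: "z \<in> complex_hyperplane \<xi> \<Longrightarrow> c *s z \<in> complex_hyperplane \<xi>"
  by (simp add: complex_hyperplane_eq herm_scale_left)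

definition line_frame :: "complex ^ 'n \<Rightarrow> (complex ^ 'n) set" where
  "line_frame w = {w, \<i> *s w}"

lemma line_frame:
  assumes "norm w = 1"
  shows "finite (line_frame w)" "pairwise orthogonal (line_frame w)" "\<forall>b\<in>line_frame w. norm b = 1"
    "card (line_frame w) = 2"
    "orthonormal_basis_of (span (line_frame w)) (line_frame w)"
proof -
  have o: "w \<bullet> (\<i> *s w) = 0" by (simp add: inner_i_eq_Im_herm herm_self)
  have "w \<noteq> \<i> *s w"
    using o assms by (metis inner_eq_zero_iff norm_zero zero_neq_one)
  then show "card (line_frame w) = 2" by (simp add: line_frame_def)
  show "finite (line_frame w)" by (simp add: line_frame_def)
  show p: "pairwise orthogonal (line_frame w)"
    using o by (auto simp: line_frame_def pairwise_def orthogonal_def inner_commute)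
  show n: "\<forall>b\<in>line_frame w. norm b = 1" using assms by (auto simp: line_frame_def norm_scale)
  show "orthonormal_basis_of (span (line_frame w)) (line_frame w)"
    using p n by (simp add: orthonormal_basis_of_def)
qed

lemma span_line_frame: "y \<in> span (line_frame w) \<Longrightarrow> \<exists>c. y = c *s w"
proof -
  assume "y \<in> span (line_frame w)"
  then obtain a b where "y = a *\<^sub>R w + b *\<^sub>R (\<i> *s w)"
    unfolding line_frame_def span_insert by (auto simp: algebra_simps)
  then have "y = (of_real a + of_real b * \<i>) *s w"
    by (simp add: scaleR_eq_scale scale_add_left)
  then show ?thesis by blast
qed

text \<open>
  Integration over a subspace is split along the complex line of \<open>w\<close> and its orthogonal complement.
  The squared length of the component on the line is the squared modulus of \<open>herm x w\<close>; thus
  conditions on one complex coordinate and on the norm become conditions on the lengths of the two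
  components.
\<close>

lemma complex_line_split:
  fixes w :: "complex ^ 'n"
  assumes S: "subspace S" and w: "w \<in> S" "\<i> *s w \<in> S" "norm w = 1"
  obtains C where "orthonormal_basis_of S (line_frame w \<union> C)" "orthonormal_basis_of (span C) C"
    "card C + 2 = dim S"
    "\<And>f. f \<in> borel_measurable borel \<Longrightarrow> (\<integral>\<^sup>+x. f x \<partial>basis_lebesgue (line_frame w \<union> C))
        = (\<integral>\<^sup>+y. \<integral>\<^sup>+z. f (y + z) \<partial>basis_lebesgue C \<partial>basis_lebesgue (line_frame w))"
    "\<And>y z. y \<in> span (line_frame w) \<Longrightarrow> z \<in> span C \<Longrightarrow> (norm (y + z))\<^sup>2 = (norm y)\<^sup>2 + (norm z)\<^sup>2"
    "\<And>y z. y \<in> span (line_frame w) \<Longrightarrow> z \<in> span C \<Longrightarrow> (cmod (herm (y + z) w))\<^sup>2 = (norm y)\<^sup>2"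
proof -
  note P = line_frame[OF w(3)]
  have "line_frame w \<subseteq> S" using w by (simp add: line_frame_def)
  from orthonormal_basis_extend[OF S this P(2,3,1)]
  obtain C where C: "orthonormal_basis_of S (line_frame w \<union> C)" "line_frame w \<inter> C = {}" "finite C"
    "orthonormal_basis_of (span C) C" "\<And>b c. b \<in> line_frame w \<Longrightarrow> c \<in> span C \<Longrightarrow> b \<bullet> c = 0" by metis
  have hz: "herm z w = 0" if "z \<in> span C" for z
    using C(5)[of w z] C(5)[of "\<i> *s w" z] that
    by (simp add: line_frame_def herm_eq_0_iff_line_frame)
  have 1: "card C + 2 = dim S"
    using orthonormal_basis_of_facts(2)[OF C(1)] card_Un_disjoint[OF P(1) C(3,2)] P(4) by simp
  have 2: "(norm (y + z))\<^sup>2 = (norm y)\<^sup>2 + (norm z)\<^sup>2" if yz: "y \<in> span (line_frame w)" "z \<in> span C" for y z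
  proof -
    obtain c where c: "y = c *s w" using span_line_frame[OF yz(1)] by blast
    have "herm y z = c * cnj (herm z w)" by (simp add: c herm_scale_left herm_commute[of w])
    then have "y \<bullet> z = 0" using hz[OF yz(2)] by (simp add: inner_eq_Re_herm)
    then show ?thesis by (simp add: power2_norm_eq_inner inner_simps inner_commute)
  qed
  have 3: "(cmod (herm (y + z) w))\<^sup>2 = (norm y)\<^sup>2" if yz: "y \<in> span (line_frame w)" "z \<in> span C" for y z
  proof -
    obtain c where c: "y = c *s w" using span_line_frame[OF yz(1)] by blast
    show ?thesis using w(3) by (simp add: herm_add_left hz[OF yz(2)] c herm_scale_left herm_self norm_scale norm_mult)
  qed
  show ?thesis
    by (rule that[OF C(1,4) 1 nn_integral_basis_lebesgue_Un[OF P(1) C(3,2)] 2 3])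
qed

lemma dim_complex_hyperplane:
  fixes \<xi> :: "complex ^ 'n"
  assumes "norm \<xi> = 1"
  shows "dim (complex_hyperplane \<xi>) + 2 = 2 * CARD('n)"
proof -
  note P = line_frame[OF assms]
  obtain C where C: "orthonormal_basis_of UNIV (line_frame \<xi> \<union> C)" "line_frame \<xi> \<inter> C = {}" "finite C"
    "orthonormal_basis_of (span C) C" "\<And>b c. b \<in> line_frame \<xi> \<Longrightarrow> c \<in> span C \<Longrightarrow> b \<bullet> c = 0"
    using orthonormal_basis_extend[OF subspace_UNIV _ P(2,3,1)] by (metis top_greatest)
  have H: "x \<in> complex_hyperplane \<xi> \<longleftrightarrow> (\<forall>b\<in>line_frame \<xi>. b \<bullet> x = 0)" for x
    by (simp add: line_frame_def complex_hyperplane_eq herm_eq_0_iff_line_frame)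
  have "complex_hyperplane \<xi> \<subseteq> span C"
  proof
    fix x assume x: "x \<in> complex_hyperplane \<xi>"
    have "x \<in> span (line_frame \<xi> \<union> C)" using C(1) by (simp add: orthonormal_basis_of_def)
    then obtain y z where yz: "y \<in> span (line_frame \<xi>)" "z \<in> span C" "x = y + z"
      unfolding span_Un by blast
    have z: "z \<in> complex_hyperplane \<xi>" using C(5) yz(2) by (simp add: H)
    obtain c where c: "y = c *s \<xi>" using span_line_frame[OF yz(1)] by blast
    have "c = 0" using x z assms by (simp add: complex_hyperplane_eq yz(3) herm_add_left c herm_scale_left herm_self)
    then show "x \<in> span C" using yz c by simp
  qed
  moreover have "span C \<subseteq> complex_hyperplane \<xi>" using C(5) by (auto simp: H)
  ultimately have "dim (complex_hyperplane \<xi>) = card C"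
    using orthonormal_basis_of_facts(2)[OF C(4)] by auto
  moreover have "card C + 2 = DIM(complex ^ 'n)"
    using orthonormal_basis_of_facts(2)[OF C(1)] card_Un_disjoint[OF P(1) C(3,2)] P(4) by simp
  ultimately show ?thesis by simp
qed

lemma rotate_coords_eq: "rotate_coords \<theta> x = cis \<theta> *s x"
  by (simp add: rotate_coords_def vec_eq_iff)

lemma convex_body_cball:
  assumes "convex_body K"
  obtains e where "e > 0" "cball 0 e \<subseteq> K"
  using assms unfolding convex_body_def mem_interior_cball by blast

lemma convex_body_scaleR:
  assumes "convex_body K" "x \<in> K" "0 \<le> t" "t \<le> 1"
  shows "t *\<^sub>R x \<in> K"
proof -
  have "0 \<in> K" using assms(1) interior_subset by (auto simp: convex_body_def)
  then show ?thesis using convexD_alt[of K 0 x t] assms by (simp add: convex_body_def)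
qed

text \<open>
  The gauge recovers a closed body: if the infimum is at most \<open>1\<close>, then all
  \<open>x / (1 + 1 / (n + 1))\<close> lie in \<open>K\<close>, and they converge to \<open>x\<close>.
\<close>

lemma convex_body_mem_iff:
  fixes K :: "'a::euclidean_space set"
  assumes K: "convex_body K"
  shows "x \<in> K \<longleftrightarrow> minkowski_functional K x \<le> 1"
proof -
  let ?A = "{a. 0 \<le> a \<and> x \<in> (\<lambda>y. a *\<^sub>R y) ` K}"
  have bdd: "bdd_below ?A" by (rule bdd_belowI[of _ 0]) simp
  show ?thesis
  proof
    assume "x \<in> K"
    then have "1 \<in> ?A" by force
    then show "minkowski_functional K x \<le> 1"
      unfolding minkowski_functional_def using bdd by (rule cInf_lower)
  next
    assume le: "minkowski_functional K x \<le> 1"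
    obtain e where e: "e > 0" "cball 0 e \<subseteq> K" using convex_body_cball[OF K] .
    have ne: "?A \<noteq> {}"
    proof (cases "x = 0")
      case True then show ?thesis using e by (auto intro!: exI[of _ 0] image_eqI[of _ _ 0])
    next
      case False
      then have "norm x / e \<in> ?A"
        using e by (auto intro!: image_eqI[of _ _ "(e / norm x) *\<^sub>R x"])
      then show ?thesis by blast
    qed
    have "(1 / (1 + inverse (real (Suc n)))) *\<^sub>R x \<in> K" for n
    proof -
      let ?b = "1 + inverse (real (Suc n))"
      have "Inf ?A < ?b" using le by (simp add: minkowski_functional_def) (smt (verit) inverse_positive_iff_positive of_nat_0_le_iff)
      then obtain a where a: "a \<in> ?A" "a < ?b" using cInf_lessD[OF ne] by blast
      then obtain y where y: "y \<in> K" "x = a *\<^sub>R y" by blast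
      have "(1 / ?b) *\<^sub>R x = (a / ?b) *\<^sub>R y" using y by simp
      moreover have "(a / ?b) *\<^sub>R y \<in> K"
        using a by (intro convex_body_scaleR[OF K y(1)]) (auto simp: divide_le_eq add_pos_nonneg)
      ultimately show ?thesis by simp
    qed
    moreover have "(\<lambda>n. (1 / (1 + inverse (real (Suc n)))) *\<^sub>R x) \<longlonglongrightarrow> (1 / (1 + 0)) *\<^sub>R x"
      by (intro tendsto_intros LIMSEQ_inverse_real_of_nat) simp
    moreover have "closed K" using K compact_imp_closed by (auto simp: convex_body_def)
    ultimately show "x \<in> K" using closed_sequentially[of K] by fastforce
  qed
qed

text \<open>
  In polar form \<open>c\<close> is a rotation followed by a contraction towards the origin. So the trace of an
  invariant body on a complex line through the origin is a disc.
\<close>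

lemma R_invariant_scale:
  fixes x :: "complex ^ 'n"
  assumes K: "convex_body K" "R_invariant K" and x: "x \<in> K" and c: "cmod c \<le> 1"
  shows "c *s x \<in> K"
proof -
  have "minkowski_functional K (rotate_coords (Arg2pi c) x) = minkowski_functional K x"
    using K(2)[unfolded R_invariant_def, THEN bspec, of "Arg2pi c"] Arg2pi_ge_0[of c] Arg2pi_lt_2pi[of c]
    by (simp add: less_imp_le)
  then have "rotate_coords (Arg2pi c) x \<in> K" using x convex_body_mem_iff[OF K(1)] by simp
  from convex_body_scaleR[OF K(1) this norm_ge_zero c]
  have "cmod c *\<^sub>R rotate_coords (Arg2pi c) x \<in> K" .
  moreover have "cmod c *\<^sub>R rotate_coords (Arg2pi c) x = c *s x"
    using Arg2pi_eq[of c] by (simp add: scaleR_eq_scale rotate_coords_eq cis_conv_exp vector_smult_assoc)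
  ultimately show ?thesis by simp
qed

lemma R_invariantI:
  fixes K :: "(complex ^ 'n) set"
  assumes "\<And>\<theta> x. x \<in> K \<Longrightarrow> rotate_coords \<theta> x \<in> K"
  shows "R_invariant K"
proof -
  have "x \<in> (\<lambda>y. a *\<^sub>R y) ` K \<longleftrightarrow> rotate_coords \<theta> x \<in> (\<lambda>y. a *\<^sub>R y) ` K" for x :: "complex ^ 'n" and \<theta> a
  proof -
    have rot: "rotate_coords s x \<in> (\<lambda>y. a *\<^sub>R y) ` K" if xx: "x \<in> (\<lambda>y. a *\<^sub>R y) ` K" for s x
    proof -
      obtain y where y: "y \<in> K" "x = a *\<^sub>R y" using xx by blast
      have "rotate_coords s x = a *\<^sub>R rotate_coords s y" by (simp add: y rotate_coords_def vec_eq_iff)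
      then show ?thesis using assms[OF y(1)] by blast
    qed
    have "rotate_coords (- \<theta>) (rotate_coords \<theta> x) = x"
      by (simp add: rotate_coords_def vec_eq_iff mult.assoc[symmetric] cis_mult)
    then show ?thesis using rot[of x \<theta>] rot[of "rotate_coords \<theta> x" "- \<theta>"] by auto
  qed
  then show ?thesis by (simp add: R_invariant_def minkowski_functional_def)
qed

section \<open>Complex dimensions one and two\<close>

lemma scale_le_1:
  fixes x :: "complex ^ 'n"
  assumes "norm (c *s x) \<le> norm x" "x \<noteq> 0"
  shows "cmod c \<le> 1"
  using assms by (simp add: norm_scale)

lemma dim1_body_is_disc:
  fixes K :: "(complex ^ 'n) set"
  assumes n: "CARD('n) = 1" and K: "convex_body K" "R_invariant K"
  shows "\<exists>r>0. K = cball 0 r"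
proof -
  obtain i where i: "(UNIV :: 'n set) = {i}" using n card_1_singletonE by blast
  have eq: "z = w \<longleftrightarrow> z $ i = w $ i" for z w :: "complex ^ 'n"
    using i by (metis UNIV_I singletonD vec_eq_iff)
  obtain e where e: "e > 0" "cball 0 e \<subseteq> K" using convex_body_cball[OF K(1)] .
  have "compact K" "K \<noteq> {}" using K(1) e by (auto simp: convex_body_def)
  from distance_attains_sup[OF this, of 0]
  obtain x where x: "x \<in> K" "\<And>y. y \<in> K \<Longrightarrow> norm y \<le> norm x" by auto
  have "e *\<^sub>R axis i 1 \<in> K" using e by (auto simp: norm_axis_1)
  then have "e \<le> norm x" using x(2) e(1) by (fastforce simp: norm_axis_1)
  then have r: "norm x > 0" using e(1) by linarith
  then have xi: "x $ i \<noteq> 0" using eq[of x 0] by auto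
  have "cball 0 (norm x) \<subseteq> K"
  proof
    fix y :: "complex ^ 'n" assume y: "y \<in> cball 0 (norm x)"
    have yx: "y = (y $ i / x $ i) *s x" using xi by (simp add: eq)
    have "cmod (y $ i / x $ i) \<le> 1"
      using y yx r by (intro scale_le_1[of _ x]) (auto simp del: norm_scale)
    then show "y \<in> K" using R_invariant_scale[OF K x(1)] yx by metis
  qed
  moreover have "K \<subseteq> cball 0 (norm x)" using x(2) by auto
  ultimately show ?thesis using r by blast
qed

text \<open>
  In dimension two the vector \<open>(- cnj b, cnj a)\<close> is a normal of the complex line through
  \<open>(a, b)\<close>.
\<close>

lemma dim2_line_is_hyperplane:
  fixes x :: "complex ^ 'n"
  assumes n: "CARD('n) = 2" and x: "x \<noteq> 0"
  obtains \<xi> where "norm \<xi> = 1" "x \<in> complex_hyperplane \<xi>"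
    "\<And>z. z \<in> complex_hyperplane \<xi> \<Longrightarrow> \<exists>c. z = c *s x"
proof -
  obtain a b where ab: "(UNIV :: 'n set) = {a, b}" "a \<noteq> b" using n by (auto simp: card_2_iff)
  have eq: "z = w \<longleftrightarrow> z $ a = w $ a \<and> z $ b = w $ b" for z w :: "complex ^ 'n"
    using ab(1) by (auto simp: vec_eq_iff)
  define \<xi>0 :: "complex ^ 'n" where "\<xi>0 = (\<chi> k. if k = a then - cnj (x $ b) else cnj (x $ a))"
  define \<xi> where "\<xi> = (1 / norm x) *\<^sub>R \<xi>0"
  have "norm \<xi>0 = norm x"
    using ab(2) by (simp add: norm_vec_def L2_set_def ab(1) \<xi>0_def add.commute)
  then have 1: "norm \<xi> = 1" using x by (simp add: \<xi>_def)
  have h: "z \<in> complex_hyperplane \<xi> \<longleftrightarrow> z $ b * x $ a = z $ a * x $ b" for z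
  proof -
    have "herm z \<xi> = cnj (of_real (1 / norm x)) * herm z \<xi>0"
      unfolding \<xi>_def scaleR_eq_scale by (rule herm_scale_right)
    moreover have "herm z \<xi>0 = z $ b * x $ a - z $ a * x $ b"
      using ab(2) by (simp add: herm_def ab(1) \<xi>0_def)
    ultimately show ?thesis using x by (simp add: complex_hyperplane_eq)
  qed
  have "\<exists>c. z = c *s x" if z: "z \<in> complex_hyperplane \<xi>" for z
  proof (cases "x $ a = 0")
    case True
    then have "x $ b \<noteq> 0" using x eq[of x 0] by auto
    then have "z = (z $ b / x $ b) *s x" using z True by (simp add: h eq)
    then show ?thesis by blast
  next
    case False
    then have "z = (z $ a / x $ a) *s x" using z by (simp add: h eq field_simps)
    then show ?thesis by blast
  qed
  moreover have "x \<in> complex_hyperplane \<xi>" by (simp add: h mult.commute)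
  ultimately show ?thesis using that 1 by blast
qed

lemma compact_in_ball_gap:
  fixes K :: "'a::euclidean_space set"
  assumes "compact K" "K \<subseteq> ball 0 1"
  obtains \<delta> where "\<delta> > 0" "\<And>x. x \<in> K \<Longrightarrow> \<delta> \<le> 1 - (norm x)\<^sup>2"
proof (cases "K = {}")
  case True then show ?thesis using that[of 1] by auto
next
  case False
  from distance_attains_sup[OF assms(1) this, of 0]
  obtain y where y: "y \<in> K" "\<And>x. x \<in> K \<Longrightarrow> norm x \<le> norm y" by auto
  have "norm y < 1" using y(1) assms(2) by auto
  then have "(norm y)\<^sup>2 < 1" by (simp add: abs_square_less_1)
  then show ?thesis using y(2) by (intro that[of "1 - (norm y)\<^sup>2"]) (auto intro: power_mono)
qed

lemma emeasure_lborel_unit_cball: "emeasure lborel (cball (0::'a::euclidean_space) 1) < \<infinity>"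
  using emeasure_lborel_cball_finite by (simp add: top.not_eq_extremum)

lemma emeasure_basis_lebesgue_unit_cball:
  assumes "orthonormal_basis_of S B"
  shows "emeasure (basis_lebesgue B) (cball 0 1) < \<infinity>"
  using emeasure_basis_lebesgue_cball[OF assms, of 1] by simp

lemma hvol_mono:
  fixes K L :: "(complex ^ 'n) set"
  assumes "compact K" "compact L" "K \<subseteq> L" "L \<subseteq> ball 0 1"
  shows "hvol K \<le> hvol L"
proof -
  obtain \<delta> where \<delta>: "\<delta> > 0" "\<And>x. x \<in> L \<Longrightarrow> \<delta> \<le> 1 - (norm x)\<^sup>2"
    using compact_in_ball_gap[OF assms(2,4)] by blast
  note i = set_lebesgue_integral_inverse_power[OF sets_lborel emeasure_lborel_unit_cball _ \<delta>(1)]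
  have "ennreal (LINT x:K|lborel. 1 / (1 - (norm x)\<^sup>2) ^ (CARD('n) + 1))
     \<le> ennreal (LINT x:L|lborel. 1 / (1 - (norm x)\<^sup>2) ^ (CARD('n) + 1))"
    using assms \<delta>(2) by (subst (1 2) i(1)[symmetric])
      (auto intro!: nn_integral_mono simp: borel_compact indicator_def)
  then show ?thesis using i(2)[of L "CARD('n) + 1"] assms(2) \<delta>(2)
    by (simp add: hvol_def borel_compact del: power_Suc)
qed

text \<open>
  If \<open>x\<close> lies in \<open>K\<close> but not in \<open>L\<close>, then on the complex line through
  \<open>x\<close> the disc of \<open>K\<close> contains that of \<open>L\<close> together with an annulus. The annulus
  has positive measure and the weight is at least \<open>1\<close>, so the section of \<open>K\<close> is strictly larger.
\<close>

lemma dim2_section_comparison_subset: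
  fixes K L :: "(complex ^ 'n) set"
  assumes n: "CARD('n) = 2"
    and K: "convex_body K" "R_invariant K" "K \<subseteq> ball 0 1"
    and L: "convex_body L" "R_invariant L" "L \<subseteq> ball 0 1"
    and le: "\<And>\<xi>. norm \<xi> = 1 \<Longrightarrow> hvol_section K \<xi> \<le> hvol_section L \<xi>"
  shows "K \<subseteq> L"
proof
  fix x assume xK: "x \<in> K"
  show "x \<in> L"
  proof (rule ccontr)
    assume xL: "x \<notin> L"
    have L0: "0 \<in> L" using convex_body_cball[OF L(1)] by (metis centre_in_cball less_imp_le subsetD)
    have x0: "x \<noteq> 0" using xL L0 by auto
    obtain \<xi> where \<xi>: "norm \<xi> = 1" "x \<in> complex_hyperplane \<xi>"
      "\<And>z. z \<in> complex_hyperplane \<xi> \<Longrightarrow> \<exists>c. z = c *s x"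
      using dim2_line_is_hyperplane[OF n x0] by blast
    define H where "H = complex_hyperplane \<xi>"
    have sH: "subspace H" by (simp add: H_def subspace_complex_hyperplane)
    have Kdisc: "z \<in> K" if z: "z \<in> H" "norm z \<le> norm x" for z
    proof -
      obtain c where c: "z = c *s x" using \<xi>(3) z(1) by (auto simp: H_def)
      show ?thesis unfolding c
        using z(2) c x0 by (intro R_invariant_scale[OF K(1,2) xK] scale_le_1[of _ x]) auto
    qed
    have Ldisc: "norm z < norm x" if z: "z \<in> H \<inter> L" for z
    proof (rule ccontr)
      assume "\<not> norm z < norm x"
      then have ge: "norm x \<le> norm z" by simp
      obtain c where c: "z = c *s x" using \<xi>(3) z(1) by (auto simp: H_def)
      have z0: "z \<noteq> 0" using ge x0 by auto
      then have "c \<noteq> 0" using c by auto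
      then have xc: "x = inverse c *s z" by (simp add: c vector_smult_assoc)
      have "inverse c *s z \<in> L"
        using ge xc z z0 by (intro R_invariant_scale[OF L(1,2)] scale_le_1[of _ z]) auto
      then show False using xL xc by simp
    qed
    have cK: "compact K" and cL: "compact L" using K(1) L(1) by (auto simp: convex_body_def)
    have clH: "closed H" using closed_subspace[OF sH] .
    have "compact (H \<inter> L)" "H \<inter> L \<noteq> {}"
      using closed_Int_compact[OF clH cL] L0 subspace_0[OF sH] by auto
    from distance_attains_sup[OF this, of 0]
    obtain y where y: "y \<in> H \<inter> L" "\<And>z. z \<in> H \<inter> L \<Longrightarrow> norm z \<le> norm y" by auto
    \<comment> \<open>a positive radius even if the section of \<open>L\<close> is only the origin\<close>
    define r where "r = max (norm y) (norm x / 2)"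
    have r: "0 < r" "r < norm x" "\<And>z. z \<in> H \<inter> L \<Longrightarrow> norm z \<le> r"
      using Ldisc[OF y(1)] x0 y(2) by (auto simp: r_def less_max_iff_disj intro: order_trans[of _ "norm y"])
    define S where "S = {z :: complex ^ 'n. r\<^sup>2 < (norm z)\<^sup>2 \<and> (norm z)\<^sup>2 \<le> (norm x)\<^sup>2}"
    have [measurable]: "S \<in> sets borel" "H \<in> sets borel" "K \<in> sets borel" "L \<in> sets borel"
      using clH cK cL by (auto simp: S_def borel_compact borel_closed)
    obtain B where B: "orthonormal_basis_of H B" using orthonormal_basis_of_exists[OF sH] by blast
    have spB: "span B = H" using B by (simp add: orthonormal_basis_of_def)
    have "card B + 2 = 2 * CARD('n)"
      using dim_complex_hyperplane[OF \<xi>(1)] orthonormal_basis_of_facts(2)[OF B] by (simp add: H_def)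
    then have cB: "card B = 2 * 1" using n by simp
    let ?M = "basis_lebesgue B"
    let ?f = "\<lambda>x :: complex ^ 'n. 1 / (1 - (norm x)\<^sup>2) ^ CARD('n)"
    have S0: "emeasure ?M S > 0"
      unfolding S_def using r emeasure_basis_lebesgue_shell[OF B cB, of "r\<^sup>2" "(norm x)\<^sup>2"]
      by (simp add: power_strict_mono power_mono)
    have ge: "(\<integral>\<^sup>+x\<in>L \<inter> H. ennreal (?f x) \<partial>?M) + emeasure ?M S \<le> (\<integral>\<^sup>+x\<in>K \<inter> H. ennreal (?f x) \<partial>?M)"
    proof -
      have "(\<integral>\<^sup>+x\<in>L \<inter> H. ennreal (?f x) \<partial>?M) + emeasure ?M S
          = (\<integral>\<^sup>+x. ennreal (?f x) * indicator (L \<inter> H) x + indicator S x \<partial>?M)"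
        by (subst nn_integral_add) auto
      also have "\<dots> \<le> (\<integral>\<^sup>+x\<in>K \<inter> H. ennreal (?f x) \<partial>?M)"
      proof (rule nn_integral_basis_lebesgue_mono)
        fix z assume "z \<in> span B"
        then have zH: "z \<in> H" by (simp add: spB)
        show "ennreal (?f z) * indicator (L \<inter> H) z + indicator S z \<le> ennreal (?f z) * indicator (K \<inter> H) z"
        proof (cases "z \<in> S")
          case True
          then have "r < norm z" "norm z \<le> norm x"
            using r(1) by (auto simp: S_def intro: power2_less_imp_less power2_le_imp_le)
          then have "z \<notin> L" "z \<in> K" using r(3)[of z] zH Kdisc[OF zH] by auto
          then have "norm z < 1" using K(3) by auto
          then have "0 < 1 - (norm z)\<^sup>2" by (simp add: abs_square_less_1)
          then have "1 \<le> ?f z" by (simp add: power_le_one)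
          then have "ennreal 1 \<le> ennreal (?f z)" by (rule ennreal_leI)
          then show ?thesis using True \<open>z \<notin> L\<close> \<open>z \<in> K\<close> zH by simp
        next
          case False
          have "z \<in> K" if "z \<in> L" using Kdisc[OF zH] r(2) r(3)[of z] that zH by auto
          then show ?thesis using False by (auto simp: indicator_def)
        qed
      qed measurable
      finally show ?thesis .
    qed
    have conv: "(\<integral>\<^sup>+x\<in>A \<inter> H. ennreal (?f x) \<partial>?M) = ennreal (LINT x:A \<inter> H|?M. ?f x)
        \<and> 0 \<le> (LINT x:A \<inter> H|?M. ?f x)"
      if A: "compact A" "A \<subseteq> ball 0 1" for A
    proof -
      obtain \<delta> where \<delta>: "\<delta> > 0" "\<And>x. x \<in> A \<Longrightarrow> \<delta> \<le> 1 - (norm x)\<^sup>2"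
        using compact_in_ball_gap[OF A] by blast
      show ?thesis
        using A(1) \<delta>(2) by (intro conjI set_lebesgue_integral_inverse_power[OF _ emeasure_basis_lebesgue_unit_cball[OF B] _ \<delta>(1)])
          (auto simp: borel_compact)
    qed
    have "(LINT x:K \<inter> H|?M. ?f x) \<le> (LINT x:L \<inter> H|?M. ?f x)"
      using le[OF \<xi>(1)] by (simp add: hvol_section_def H_def[symmetric] subspace_lebesgue_eq[OF B])
    then have "ennreal (LINT x:K \<inter> H|?M. ?f x) \<le> ennreal (LINT x:L \<inter> H|?M. ?f x)"
      by (rule ennreal_leI)
    then have "ennreal (LINT x:L \<inter> H|?M. ?f x) + emeasure ?M S \<le> ennreal (LINT x:L \<inter> H|?M. ?f x) + 0"
      using order_trans[OF ge] conv[OF cK K(3)] conv[OF cL L(3)] by simp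
    then have "emeasure ?M S \<le> 0" by (subst (asm) ennreal_add_left_cancel_le) simp
    then show False using S0 by simp
  qed
qed

section \<open>Complex dimension at least three\<close>

text \<open>
  A disc in the coordinate \<open>i\<close> times a ball in the remaining coordinates, both of squared radius
  \<open>p\<close>. The second condition is phrased through the full norm because only that quantity survives
  the passage to a hyperplane.
\<close>

definition bidisc :: "'n::finite \<Rightarrow> real \<Rightarrow> (complex ^ 'n) set" where
  "bidisc i p = {x. (cmod (x $ i))\<^sup>2 \<le> p \<and> (norm x)\<^sup>2 - (cmod (x $ i))\<^sup>2 \<le> p}"

lemma norm_squared_split:
  fixes x :: "complex ^ 'n"
  shows "(norm x)\<^sup>2 = (cmod (x $ i))\<^sup>2 + (norm (\<chi> k. if k = i then 0 else x $ k))\<^sup>2"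
proof -
  have "(norm x)\<^sup>2 = (\<Sum>k\<in>UNIV. (cmod (x $ k))\<^sup>2)"
    by (simp add: norm_vec_def L2_set_def sum_nonneg)
  also have "\<dots> = (cmod (x $ i))\<^sup>2 + (\<Sum>k\<in>UNIV - {i}. (cmod (x $ k))\<^sup>2)"
    by (rule sum.remove) auto
  also have "(\<Sum>k\<in>UNIV - {i}. (cmod (x $ k))\<^sup>2) = (\<Sum>k\<in>UNIV. (cmod (if k = i then 0 else x $ k))\<^sup>2)"
    by (rule sum.mono_neutral_cong_left) auto
  also have "\<dots> = (norm (\<chi> k. if k = i then 0 else x $ k))\<^sup>2"
    by (simp add: norm_vec_def L2_set_def sum_nonneg)
  finally show ?thesis .
qed

lemma closed_bidisc: "closed (bidisc i p)"
  unfolding bidisc_def by (intro closed_Collect_conj closed_Collect_le continuous_intros)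

lemma borel_bidisc [measurable]: "bidisc i p \<in> sets borel"
  by (intro borel_closed closed_bidisc)

lemma bidisc_body:
  fixes i :: "'n::finite"
  assumes p: "0 < p"
  shows "convex_body (bidisc i p)" "R_invariant (bidisc i p)"
proof -
  define Q :: "complex ^ 'n \<Rightarrow> complex ^ 'n" where "Q x = (\<chi> k. if k = i then 0 else x $ k)" for x
  have Q: "linear Q" by (rule linearI) (auto simp: Q_def vec_eq_iff)
  have i: "linear (\<lambda>x :: complex ^ 'n. x $ i)" by (rule linearI) auto
  have sq: "norm y \<le> sqrt p \<longleftrightarrow> (norm y)\<^sup>2 \<le> p" for y :: "'b::real_normed_vector"
    using real_sqrt_le_iff[of "(norm y)\<^sup>2" p] by simp
  have norm_Q: "(norm (Q x))\<^sup>2 = (norm x)\<^sup>2 - (cmod (x $ i))\<^sup>2" for x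
    using norm_squared_split[of x i] unfolding Q_def by linarith
  have eq: "bidisc i p = (\<lambda>x. x $ i) -` cball 0 (sqrt p) \<inter> Q -` cball 0 (sqrt p)"
    by (auto simp: bidisc_def sq norm_Q)
  have "convex (bidisc i p)"
    unfolding eq by (intro convex_Int convex_linear_vimage i Q convex_cball)
  moreover have "compact (bidisc i p)"
  proof -
    have "bidisc i p \<subseteq> cball 0 (sqrt (2 * p))"
      by (auto simp: bidisc_def intro!: real_le_rsqrt)
    then show ?thesis using closed_bidisc by (meson bounded_cball bounded_subset compact_eq_bounded_closed)
  qed
  moreover have "cball 0 (sqrt p) \<subseteq> bidisc i p"
  proof
    fix x :: "complex ^ 'n" assume "x \<in> cball 0 (sqrt p)"
    then have "(norm x)\<^sup>2 \<le> p" by (simp add: sq)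
    then show "x \<in> bidisc i p" using norm_squared_split[of x i] by (auto simp: bidisc_def)
      (smt (verit) zero_le_power2)+
  qed
  then have "0 \<in> interior (bidisc i p)" using p by (auto simp: mem_interior_cball intro!: exI[of _ "sqrt p"])
  ultimately show "convex_body (bidisc i p)" by (simp add: convex_body_def)
  show "R_invariant (bidisc i p)"
    by (rule R_invariantI) (auto simp: bidisc_def norm_rotate_coords, auto simp: rotate_coords_def norm_mult)
qed

text \<open>
  The first summand handles wide layers, for which the whole unit ball is an adequate bound; the
  second is the product of the bounds for the two radial variables of a thin layer.
\<close>

definition section_layer_const :: "nat \<Rightarrow> real" where
  "section_layer_const n = 16 * unit_ball_vol (2 * (n - 1)) +
     4 * unit_ball_vol 2 * (unit_ball_vol (2 * (n - 2)) * (n - 2))"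

text \<open>
  Let \<open>v\<close> be the orthogonal projection of the \<open>i\<close>-th unit vector to the hyperplane, with
  squared length \<open>\<tau>\<close>. On the hyperplane the coordinate \<open>x $ i\<close> equals
  \<open>herm x v\<close>; so for the decomposition \<open>x = y + z\<close> along the line of \<open>v\<close> its squared
  modulus is \<open>\<tau> * norm y ^ 2\<close>. In a layer of width \<open>t\<close> both parts of \<open>x\<close> have
  squared length within \<open>t\<close> of \<open>1/2\<close>. This puts \<open>y\<close> into an annulus of width
  \<open>t / \<tau>\<close> and, for given \<open>y\<close>, puts \<open>z\<close> into a shell of width \<open>t\<close>. The
  estimate is uniform in the hyperplane because \<open>\<tau> \<ge> 1/4\<close> whenever a thin layer meets it at
  all. The assumption on the dimension leaves \<open>z\<close> at least two real dimensions; for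
  \<open>z = 0\<close> only one factor \<open>t\<close> would be gained.
\<close>

lemma bidisc_section_layer:
  fixes \<xi> :: "complex ^ 'n" and i :: 'n
  assumes N: "CARD('n) \<ge> 3" and \<xi>: "norm \<xi> = 1" and t: "0 < t"
    and B: "orthonormal_basis_of (complex_hyperplane \<xi>) B"
  shows "emeasure (basis_lebesgue B) {x \<in> bidisc i (1/2). 1 - (norm x)\<^sup>2 < t}
    \<le> ennreal (section_layer_const CARD('n) * t\<^sup>2)"
proof -
  define N where "N = CARD('n)"
  have N3: "N \<ge> 3" using N by (simp add: N_def)
  define X where "X = {x \<in> bidisc i (1/2). 1 - (norm x)\<^sup>2 < t}"
  define H where "H = complex_hyperplane \<xi>"
  have sH: "subspace H" by (simp add: H_def subspace_complex_hyperplane)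
  have dH: "dim H + 2 = 2 * N" using dim_complex_hyperplane[OF \<xi>] by (simp add: H_def N_def)
  have BH: "orthonormal_basis_of H B" "span B = H" using B by (auto simp: H_def orthonormal_basis_of_def)
  have cB: "card B = 2 * (N - 1)" using orthonormal_basis_of_facts(2)[OF BH(1)] dH by simp
  have [measurable]: "X \<in> sets borel"
    unfolding X_def by measurable
  define V where "V k = unit_ball_vol (real k)" for k
  have V0: "V k \<ge> 0" for k by (simp add: V_def)
  have const: "section_layer_const N = 16 * V (2 * (N - 1)) + 4 * V 2 * (V (2 * (N - 2)) * (N - 2))"
    by (simp add: section_layer_const_def V_def)
  have Xball: "norm x \<le> 1" if "x \<in> X" for x
  proof -
    have "(norm x)\<^sup>2 \<le> 1" using that by (simp add: X_def bidisc_def)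
    then show ?thesis by (simp add: abs_square_le_1)
  qed
  have "emeasure (basis_lebesgue B) X \<le> ennreal (section_layer_const N * t\<^sup>2)"
  proof (cases "t \<ge> 1/4")
    case True
    have "emeasure (basis_lebesgue B) X \<le> emeasure (basis_lebesgue B) (cball 0 1)"
      using Xball by (intro emeasure_mono) auto
    also have "\<dots> = ennreal (V (2 * (N - 1)) * 1)"
      using emeasure_basis_lebesgue_cball[OF BH(1), of 1] by (simp add: cB V_def)
    also have "\<dots> \<le> ennreal (section_layer_const N * t\<^sup>2)"
    proof (rule ennreal_leI)
      have "(1/4)\<^sup>2 \<le> t\<^sup>2" using True by (intro power_mono) auto
      then have "1 \<le> 16 * t\<^sup>2" by (simp add: power2_eq_square)
      then have "V (2 * (N - 1)) * 1 \<le> V (2 * (N - 1)) * (16 * t\<^sup>2)" using V0 by (intro mult_left_mono)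
      also have "\<dots> \<le> section_layer_const N * t\<^sup>2" using V0 by (simp add: const algebra_simps)
      finally show "V (2 * (N - 1)) * 1 \<le> section_layer_const N * t\<^sup>2" .
    qed
    finally show ?thesis .
  next
    case False
    define \<tau> where "\<tau> = 1 - (cmod (\<xi> $ i))\<^sup>2"
    define v :: "complex ^ 'n" where "v = axis i 1 - cnj (\<xi> $ i) *s \<xi>"
    have xi: "herm x v = x $ i" if "x \<in> H" for x
      using that by (simp add: v_def herm_diff_right herm_axis_right herm_scale_right H_def complex_hyperplane_eq)
    have vH: "v \<in> H"
    proof -
      have "herm v \<xi> = cnj (herm \<xi> v)" by (rule herm_commute)
      also have "herm \<xi> v = 0"
        using \<xi> by (simp add: v_def herm_diff_right herm_axis_right herm_scale_right herm_self)
      finally show ?thesis by (simp add: H_def complex_hyperplane_eq)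
    qed
    have "of_real ((norm v)\<^sup>2) = (of_real \<tau> :: complex)"
    proof -
      have "of_real ((norm v)\<^sup>2) = v $ i" using xi[OF vH] by (simp add: herm_self)
      also have "\<dots> = 1 - \<xi> $ i * cnj (\<xi> $ i)" by (simp add: v_def axis_def mult.commute)
      also have "\<dots> = of_real \<tau>" unfolding complex_norm_square[symmetric] by (simp add: \<tau>_def)
      finally show ?thesis .
    qed
    then have nv: "(norm v)\<^sup>2 = \<tau>" using of_real_eq_iff by blast
    have near: "1/2 - t < (cmod (x $ i))\<^sup>2" if "x \<in> X" for x
      using that by (simp add: X_def bidisc_def)
    show ?thesis
    proof (cases "\<tau> < 1/4")
      case True
      have empty: "x \<notin> X" if "x \<in> H" for x
      proof
        assume x: "x \<in> X"
        have "cmod (x $ i) \<le> norm x * norm v" using cmod_herm_le[of x v] xi[OF that] by simp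
        also have "\<dots> \<le> 1 * norm v" using Xball[OF x] by (intro mult_right_mono) auto
        finally have "(cmod (x $ i))\<^sup>2 \<le> \<tau>" using nv power_mono[of "cmod (x $ i)" "norm v" 2] by simp
        then show False using near[OF x] True False by simp
      qed
      have "emeasure (basis_lebesgue B) X = (\<integral>\<^sup>+x. indicator X x \<partial>basis_lebesgue B)" by simp
      also have "\<dots> = (\<integral>\<^sup>+x. 0 \<partial>basis_lebesgue B)"
        using empty BH(2) by (intro nn_integral_basis_lebesgue_cong) auto
      finally show ?thesis by simp
    next
      case \<tau>4: False
      define w where "w = (1 / norm v) *\<^sub>R v"
      have v0: "norm v > 0" using nv \<tau>4 by (cases "v = 0") auto
      have w: "norm w = 1" "w \<in> H" "\<i> *s w \<in> H"
        using v0 vH sH by (auto simp: w_def subspace_scale H_def intro!: scale_in_complex_hyperplane)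
      have xw: "(cmod (x $ i))\<^sup>2 = \<tau> * (cmod (herm x w))\<^sup>2" if "x \<in> H" for x
      proof -
        have "herm x w = of_real (1 / norm v) * (x $ i)"
          unfolding w_def scaleR_eq_scale herm_scale_right using xi[OF that] by simp
        then have "cmod (herm x w) = cmod (x $ i) / norm v" by (simp add: norm_divide)
        then show ?thesis using v0 by (simp add: power_divide flip: nv)
      qed
      obtain C where C: "orthonormal_basis_of H (line_frame w \<union> C)" "orthonormal_basis_of (span C) C"
        "card C + 2 = dim H"
        "\<And>f. f \<in> borel_measurable borel \<Longrightarrow> (\<integral>\<^sup>+x. f x \<partial>basis_lebesgue (line_frame w \<union> C))
            = (\<integral>\<^sup>+y. \<integral>\<^sup>+z. f (y + z) \<partial>basis_lebesgue C \<partial>basis_lebesgue (line_frame w))"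
        "\<And>y z. y \<in> span (line_frame w) \<Longrightarrow> z \<in> span C \<Longrightarrow> (norm (y + z))\<^sup>2 = (norm y)\<^sup>2 + (norm z)\<^sup>2"
        "\<And>y z. y \<in> span (line_frame w) \<Longrightarrow> z \<in> span C \<Longrightarrow> (cmod (herm (y + z) w))\<^sup>2 = (norm y)\<^sup>2"
        by (rule complex_line_split[OF sH w(2,3,1)]) (rule that)
      have spH: "span (line_frame w \<union> C) = H" using C(1) by (simp add: orthonormal_basis_of_def)
      have cC: "card C = 2 * (N - 2)" using C(3) dH by simp
      note fC = orthonormal_basis_of_facts(1)[OF C(2)]
      \<comment> \<open>the cut at \<open>1\<close> keeps the annulus inside the unit disc, where the shell estimate applies\<close>
      define a b where "a = (1/2 - t) / \<tau>" and "b = min 1 (1 / (2 * \<tau>))"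
      define Y where "Y = {y :: complex ^ 'n. a < (norm y)\<^sup>2 \<and> (norm y)\<^sup>2 \<le> b}"
      define E where "E = ennreal (V (2 * (N - 2)) * (N - 2) * t)"
      have [measurable]: "Y \<in> sets borel" by (simp add: Y_def)
      have inner: "(\<integral>\<^sup>+z. indicator X (y + z) \<partial>basis_lebesgue C) \<le> E * indicator Y y"
        if y: "y \<in> span (line_frame w)" for y
      proof -
        define Z where "Z = {z :: complex ^ 'n. 1 - t - (norm y)\<^sup>2 < (norm z)\<^sup>2 \<and> (norm z)\<^sup>2 \<le> 1 - (norm y)\<^sup>2}"
        have [measurable]: "Z \<in> sets borel" by (simp add: Z_def)
        have "(\<integral>\<^sup>+z. indicator X (y + z) \<partial>basis_lebesgue C)
            \<le> (\<integral>\<^sup>+z. indicator Y y * indicator Z z \<partial>basis_lebesgue C)"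
        proof (rule nn_integral_basis_lebesgue_mono)
          fix z assume z: "z \<in> span C"
          show "indicator X (y + z) \<le> (indicator Y y * indicator Z z :: ennreal)"
          proof (cases "y + z \<in> X")
            case True
            have "y + z \<in> H" unfolding spH[symmetric] span_Un using y z by blast
            from xw[OF this] have i: "(cmod ((y + z) $ i))\<^sup>2 = \<tau> * (norm y)\<^sup>2"
              unfolding C(6)[OF y z] .
            have nyz: "(norm y)\<^sup>2 + (norm z)\<^sup>2 \<le> 1" "1 - t < (norm y)\<^sup>2 + (norm z)\<^sup>2"
              using True C(5)[OF y z] by (auto simp: X_def bidisc_def)
            have ty: "1/2 - t < \<tau> * (norm y)\<^sup>2" "\<tau> * (norm y)\<^sup>2 \<le> 1/2"
              using near[OF True] True unfolding i by (auto simp: X_def bidisc_def i simp del: vector_add_component)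
            have "a < (norm y)\<^sup>2" "(norm y)\<^sup>2 \<le> 1 / (2 * \<tau>)"
              using ty \<tau>4 by (auto simp: a_def field_simps)
            moreover have "(norm y)\<^sup>2 \<le> 1" using nyz(1) by (smt (verit) zero_le_power2)
            ultimately have "y \<in> Y" by (simp add: Y_def b_def)
            moreover have "z \<in> Z" using nyz by (simp add: Z_def)
            ultimately show ?thesis using True by simp
          qed simp
        qed measurable
        also have "\<dots> = indicator Y y * emeasure (basis_lebesgue C) Z"
          by (simp add: nn_integral_cmult)
        also have "\<dots> \<le> indicator Y y * E"
        proof (rule mult_left_mono)
          have "1 \<le> N - 2" using N3 by simp
          from emeasure_basis_lebesgue_shell_le[OF C(2) cC this, of "1 - (norm y)\<^sup>2" "1 - t - (norm y)\<^sup>2"]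
          show "emeasure (basis_lebesgue C) Z \<le> E" by (simp add: Z_def E_def V_def)
        qed simp
        finally show ?thesis by (simp add: mult.commute)
      qed
      have "emeasure (basis_lebesgue B) X = emeasure (basis_lebesgue (line_frame w \<union> C)) X"
        using basis_lebesgue_unique[OF BH(1) C(1)] by simp
      also have "\<dots> = (\<integral>\<^sup>+x. indicator X x \<partial>basis_lebesgue (line_frame w \<union> C))" by simp
      also have "\<dots> = (\<integral>\<^sup>+y. \<integral>\<^sup>+z. indicator X (y + z) \<partial>basis_lebesgue C \<partial>basis_lebesgue (line_frame w))"
        by (rule C(4)) measurable
      also have "\<dots> \<le> (\<integral>\<^sup>+y. E * indicator Y y \<partial>basis_lebesgue (line_frame w))"
        by (intro nn_integral_basis_lebesgue_mono inner borel_measurable_nn_integral_basis_lebesgue fC) measurable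
      also have "\<dots> = E * emeasure (basis_lebesgue (line_frame w)) Y" by (simp add: nn_integral_cmult)
      also have "\<dots> \<le> E * ennreal (V 2 * (4 * t))"
      proof (rule mult_left_mono)
        have "b - a \<le> 1 / (2 * \<tau>) - a" by (simp add: b_def)
        also have "\<dots> = t / \<tau>" using \<tau>4 by (simp add: a_def field_simps)
        also have "\<dots> \<le> 4 * t" using \<tau>4 t by (simp add: field_simps)
        finally have ba: "b - a \<le> 4 * t" .
        have "emeasure (basis_lebesgue (line_frame w)) Y \<le> ennreal (V 2 * (b - a))"
          using emeasure_basis_lebesgue_shell_le[OF line_frame(5)[OF w(1)], of 1 b a] line_frame(4)[OF w(1)]
          by (simp add: Y_def V_def b_def)
        also have "\<dots> \<le> ennreal (V 2 * (4 * t))" using ba V0 by (intro ennreal_leI mult_left_mono)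
        finally show "emeasure (basis_lebesgue (line_frame w)) Y \<le> ennreal (V 2 * (4 * t))" .
      qed simp
      also have "\<dots> = ennreal (V (2 * (N - 2)) * (N - 2) * t * (V 2 * (4 * t)))"
        unfolding E_def using V0 t by (intro ennreal_mult[symmetric]) auto
      also have "\<dots> \<le> ennreal (section_layer_const N * t\<^sup>2)"
      proof (rule ennreal_leI)
        have "0 \<le> 16 * V (2 * (N - 1)) * t\<^sup>2" using V0 by simp
        then show "V (2 * (N - 2)) * (N - 2) * t * (V 2 * (4 * t)) \<le> section_layer_const N * t\<^sup>2"
          by (simp add: const algebra_simps power2_eq_square)
      qed
      finally show ?thesis .
    qed
  qed
  then show ?thesis by (simp add: X_def N_def)
qed

lemma bidisc_gap: "x \<in> bidisc i ((1 - \<delta>) / 2) \<Longrightarrow> \<delta> \<le> 1 - (norm x)\<^sup>2"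
  by (simp add: bidisc_def field_simps)

lemma section_layer_const_pos: "section_layer_const n > 0"
proof -
  have "0 \<le> 4 * unit_ball_vol 2 * (unit_ball_vol (2 * real (n - 2)) * real (n - 2))" by simp
  moreover have "unit_ball_vol (2 * real (n - 1)) > 0" by simp
  ultimately show ?thesis by (simp add: section_layer_const_def add_pos_nonneg)
qed

text \<open>
  The layer exponent is \<open>2\<close>, which must be less than the weight exponent \<open>CARD('n)\<close>.
\<close>

lemma hvol_section_bidisc_le:
  fixes \<xi> :: "complex ^ 'n" and i :: 'n
  assumes N: "CARD('n) \<ge> 3" and \<xi>: "norm \<xi> = 1" and \<delta>: "0 < \<delta>"
  shows "hvol_section (bidisc i ((1 - \<delta>) / 2)) \<xi>
    \<le> 8 ^ (CARD('n) - 1) * (section_layer_const CARD('n) * 8 / \<delta> ^ (CARD('n) - 2))"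
proof -
  define H where "H = complex_hyperplane \<xi>"
  have sH: "subspace H" by (simp add: H_def subspace_complex_hyperplane)
  obtain B where B: "orthonormal_basis_of H B" using orthonormal_basis_of_exists[OF sH] by blast
  define A where "A = bidisc i ((1 - \<delta>) / 2) \<inter> H"
  have [measurable]: "A \<in> sets borel"
    unfolding A_def by (intro sets.Int borel_bidisc borel_closed closed_subspace sH)
  have gap: "\<delta> \<le> 1 - (norm x)\<^sup>2" if "x \<in> A" for x using that bidisc_gap by (auto simp: A_def)
  have X: "{x \<in> bidisc i (1/2). 1 - (norm x)\<^sup>2 < t} \<in> sets borel" for t
    by measurable
  have layer: "emeasure (basis_lebesgue B) {x\<in>A. 1 - (norm x)\<^sup>2 < t} \<le> ennreal (section_layer_const CARD('n) * t\<^sup>2)"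
    if t: "t > 0" for t
  proof -
    have "emeasure (basis_lebesgue B) {x\<in>A. 1 - (norm x)\<^sup>2 < t}
        \<le> emeasure (basis_lebesgue B) {x \<in> bidisc i (1/2). 1 - (norm x)\<^sup>2 < t}"
    proof (rule emeasure_mono)
      show "{x\<in>A. 1 - (norm x)\<^sup>2 < t} \<subseteq> {x \<in> bidisc i (1/2). 1 - (norm x)\<^sup>2 < t}"
        using \<delta> by (auto simp: A_def bidisc_def)
    qed (use X in simp)
    also have "\<dots> \<le> ennreal (section_layer_const CARD('n) * t\<^sup>2)"
      using B by (intro bidisc_section_layer[OF N \<xi> t]) (simp add: H_def)
    finally show ?thesis .
  qed
  have "ennreal (LINT x:A|basis_lebesgue B. 1 / (1 - (norm x)\<^sup>2) ^ CARD('n))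
      = (\<integral>\<^sup>+x\<in>A. ennreal (1 / (1 - (norm x)\<^sup>2) ^ CARD('n)) \<partial>basis_lebesgue B)"
    using gap by (intro set_lebesgue_integral_inverse_power(1)[symmetric, OF _ emeasure_basis_lebesgue_unit_cball[OF B] _ \<delta>]) auto
  also have "\<dots> \<le> ennreal (section_layer_const CARD('n) * 2 ^ (2 + 1) / \<delta> ^ (CARD('n) - 2))"
    using gap N section_layer_const_pos[of "CARD('n)"] layer
    by (intro nn_integral_inverse_power_le[OF _ _ _ \<delta>]) auto
  finally have "(LINT x:A|basis_lebesgue B. 1 / (1 - (norm x)\<^sup>2) ^ CARD('n))
      \<le> section_layer_const CARD('n) * 8 / \<delta> ^ (CARD('n) - 2)"
    using section_layer_const_pos[of "CARD('n)"] \<delta> by (subst (asm) ennreal_le_iff) auto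
  then show ?thesis
    unfolding hvol_section_def H_def[symmetric] subspace_lebesgue_eq[OF B] A_def[symmetric]
    by (intro mult_left_mono) auto
qed

lemma cball_gap:
  assumes "x \<in> cball 0 (sqrt (1 - e))" "e < 1"
  shows "e \<le> 1 - (norm x)\<^sup>2"
proof -
  have "(norm x)\<^sup>2 \<le> (sqrt (1 - e))\<^sup>2" using assms by (intro power_mono) auto
  then show ?thesis using assms(2) by simp
qed

text \<open>
  It suffices to integrate over the outermost shell, where \<open>1 - norm x ^ 2\<close> is between \<open>e\<close>
  and \<open>2 * e\<close>.
\<close>

lemma hvol_section_cball_ge:
  fixes \<xi> :: "complex ^ 'n"
  assumes N: "CARD('n) \<ge> 3" and \<xi>: "norm \<xi> = 1" and e: "0 < e" "e \<le> 1/4"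
  shows "8 ^ (CARD('n) - 1) * (unit_ball_vol (2 * (CARD('n) - 1)) / 2 ^ (2 * CARD('n) - 2) / e ^ (CARD('n) - 1))
    \<le> hvol_section (cball 0 (sqrt (1 - e))) \<xi>"
proof -
  define N where "N = CARD('n)"
  have N3: "N \<ge> 3" using N by (simp add: N_def)
  define H where "H = complex_hyperplane \<xi>"
  have sH: "subspace H" by (simp add: H_def subspace_complex_hyperplane)
  obtain B where B: "orthonormal_basis_of H B" using orthonormal_basis_of_exists[OF sH] by blast
  have spB: "span B = H" using B by (simp add: orthonormal_basis_of_def)
  have cB: "card B = 2 * (N - 1)"
    using dim_complex_hyperplane[OF \<xi>] orthonormal_basis_of_facts(2)[OF B] by (simp add: H_def N_def)
  let ?M = "basis_lebesgue B" and ?L = "cball 0 (sqrt (1 - e)) :: (complex ^ 'n) set"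
  define S where "S = {x :: complex ^ 'n. 1 - 2 * e < (norm x)\<^sup>2 \<and> (norm x)\<^sup>2 \<le> 1 - e}"
  have [measurable]: "S \<in> sets borel" "H \<in> sets borel"
    using closed_subspace[OF sH] by (auto simp: S_def borel_closed)
  have gap: "e \<le> 1 - (norm x)\<^sup>2" if "x \<in> ?L" for x using cball_gap[OF that] e by simp
  have SL: "S \<subseteq> ?L" by (auto simp: S_def intro!: real_le_rsqrt)
  define V where "V = unit_ball_vol (2 * (N - 1))"
  have V0: "V \<ge> 0" by (simp add: V_def)
  have "ennreal (V / 2 ^ (2 * N - 2) / e ^ (N - 1)) \<le> ennreal (1 / (2 * e) ^ N * (V * (1 - 2 * e) ^ (N - 1 - 1) * ((1 - e) - (1 - 2 * e))))"
  proof (rule ennreal_leI)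
    obtain k where k: "N = k + 2" using N3 by (intro that[of "N - 2"]) auto
    have "(1/2) ^ k \<le> (1 - 2 * e) ^ k" using e by (intro power_mono) auto
    then have "V * ((1/2) ^ k) / (2 ^ N * e ^ (k + 1)) \<le> V * (1 - 2 * e) ^ k / (2 ^ N * e ^ (k + 1))"
      using V0 e by (intro divide_right_mono mult_left_mono) auto
    moreover have "V * ((1/2) ^ k) / (2 ^ N * e ^ (k + 1)) = V / 2 ^ (2 * N - 2) / e ^ (N - 1)"
    proof -
      have "2 * N - 2 = N + k" "N - 1 = k + 1" using k by auto
      then show ?thesis by (simp add: power_divide power_add mult_ac del: power_Suc)
    qed
    moreover have "V * (1 - 2 * e) ^ k / (2 ^ N * e ^ (k + 1)) = 1 / (2 * e) ^ N * (V * (1 - 2 * e) ^ (N - 1 - 1) * ((1 - e) - (1 - 2 * e)))"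
    proof -
      have "(2 * e) ^ N = 2 ^ N * (e ^ (k + 1) * e)" by (simp add: k power_mult_distrib)
      moreover have "N - 1 - 1 = k" "(1 - e) - (1 - 2 * e) = e" using k by auto
      ultimately show ?thesis using e by (simp del: power_Suc)
    qed
    ultimately show "V / 2 ^ (2 * N - 2) / e ^ (N - 1) \<le> 1 / (2 * e) ^ N * (V * (1 - 2 * e) ^ (N - 1 - 1) * ((1 - e) - (1 - 2 * e)))"
      by linarith
  qed
  also have "\<dots> = ennreal (1 / (2 * e) ^ N) * ennreal (V * (1 - 2 * e) ^ (N - 1 - 1) * ((1 - e) - (1 - 2 * e)))"
    using e V0 by (intro ennreal_mult) auto
  also have "\<dots> \<le> ennreal (1 / (2 * e) ^ N) * emeasure ?M S"
    unfolding S_def V_def using N3 e by (intro mult_left_mono emeasure_basis_lebesgue_shell_ge[OF B cB]) auto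
  also have "\<dots> \<le> (\<integral>\<^sup>+x\<in>?L. ennreal (1 / (1 - (norm x)\<^sup>2) ^ N) \<partial>?M)"
    using SL e by (intro nn_integral_inverse_power_ge) (auto simp: S_def)
  also have "\<dots> = (\<integral>\<^sup>+x\<in>?L \<inter> H. ennreal (1 / (1 - (norm x)\<^sup>2) ^ N) \<partial>?M)"
    by (intro nn_integral_basis_lebesgue_cong) (auto simp: spB indicator_def)
  also have "\<dots> = ennreal (LINT x:?L \<inter> H|?M. 1 / (1 - (norm x)\<^sup>2) ^ N)"
    using gap by (intro set_lebesgue_integral_inverse_power(1)[OF _ emeasure_basis_lebesgue_unit_cball[OF B] _ e(1)]) auto
  finally have "V / 2 ^ (2 * N - 2) / e ^ (N - 1) \<le> (LINT x:?L \<inter> H|?M. 1 / (1 - (norm x)\<^sup>2) ^ N)"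
    using gap by (subst (asm) ennreal_le_iff)
      (intro set_lebesgue_integral_inverse_power(2)[OF _ emeasure_basis_lebesgue_unit_cball[OF B] _ e(1)], auto)
  then show ?thesis
    unfolding hvol_section_def H_def[symmetric] subspace_lebesgue_eq[OF B] N_def[symmetric] V_def
    by (intro mult_left_mono) auto
qed

lemma hvol_cball_le:
  assumes e: "0 < e" "e < 1"
  shows "hvol (cball (0 :: complex ^ 'n) (sqrt (1 - e)))
    \<le> 8 ^ CARD('n) * (unit_ball_vol (2 * CARD('n)) * CARD('n) * 4 / e ^ CARD('n))"
proof -
  define N where "N = CARD('n)"
  let ?L = "cball 0 (sqrt (1 - e)) :: (complex ^ 'n) set"
  define B where "B = (Basis :: (complex ^ 'n) set)"
  have B: "orthonormal_basis_of UNIV B" by (simp add: B_def orthonormal_basis_of_Basis)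
  have cB: "card B = 2 * N" by (simp add: B_def N_def)
  have N1: "N \<ge> 1" by (simp add: N_def Suc_leI)
  have gap: "e \<le> 1 - (norm x)\<^sup>2" if "x \<in> ?L" for x using cball_gap[OF that] e by simp
  have layer: "emeasure lborel {x\<in>?L. 1 - (norm x)\<^sup>2 < t} \<le> ennreal (unit_ball_vol (2 * N) * N * t ^ 1)" for t
  proof -
    have "emeasure lborel {x\<in>?L. 1 - (norm x)\<^sup>2 < t}
        \<le> emeasure (basis_lebesgue B) {x. 1 - t < (norm x)\<^sup>2 \<and> (norm x)\<^sup>2 \<le> 1}"
      unfolding lborel_eq_basis_lebesgue[OF B]
    proof (rule emeasure_mono)
      show "{x\<in>?L. 1 - (norm x)\<^sup>2 < t} \<subseteq> {x. 1 - t < (norm x)\<^sup>2 \<and> (norm x)\<^sup>2 \<le> 1}"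
        using gap e by (force dest: less_le_trans)
    qed simp
    also have "\<dots> \<le> ennreal (unit_ball_vol (2 * N) * N * (1 - (1 - t)))"
      by (intro emeasure_basis_lebesgue_shell_le[OF B cB N1]) simp
    finally show ?thesis by simp
  qed
  have "ennreal (LINT x:?L|lborel. 1 / (1 - (norm x)\<^sup>2) ^ (N + 1))
      = (\<integral>\<^sup>+x\<in>?L. ennreal (1 / (1 - (norm x)\<^sup>2) ^ (N + 1)) \<partial>lborel)"
    using gap by (intro set_lebesgue_integral_inverse_power(1)[symmetric, OF _ emeasure_lborel_unit_cball _ e(1)]) auto
  also have "\<dots> \<le> ennreal (unit_ball_vol (2 * N) * N * 2 ^ (1 + 1) / e ^ (N + 1 - 1))"
    using gap N1 layer by (intro nn_integral_inverse_power_le[OF _ _ _ e(1)]) auto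
  finally have "(LINT x:?L|lborel. 1 / (1 - (norm x)\<^sup>2) ^ (N + 1)) \<le> unit_ball_vol (2 * N) * N * 4 / e ^ N"
    using e by (subst (asm) ennreal_le_iff) auto
  then show ?thesis unfolding hvol_def N_def[symmetric] by (intro mult_left_mono) auto
qed

text \<open>
  If both parts of \<open>x\<close> have squared length within \<open>\<delta>\<close> of the maximal value
  \<open>p = (1 - \<delta>) / 2\<close>, then \<open>1 - norm x ^ 2 \<le> 3 * \<delta>\<close>. These points form a product of two
  shells of width \<open>\<delta>\<close>, and the bound \<open>\<delta> \<le> 1/6\<close> keeps the inner squared radius
  \<open>p - \<delta>\<close> above \<open>1/4\<close>.
\<close>

lemma hvol_bidisc_ge:
  fixes i :: "'n::finite"
  assumes N: "CARD('n) \<ge> 3" and \<delta>: "0 < \<delta>" "\<delta> \<le> 1/6"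
  shows "8 ^ CARD('n) * (unit_ball_vol 2 * unit_ball_vol (2 * (CARD('n) - 1))
      / (3 ^ (CARD('n) + 1) * 4 ^ (CARD('n) - 2)) / \<delta> ^ (CARD('n) - 1)) \<le> hvol (bidisc i ((1 - \<delta>) / 2))"
proof -
  define N where "N = CARD('n)"
  have N3: "N \<ge> 3" using N by (simp add: N_def)
  define p where "p = (1 - \<delta>) / 2"
  define K where "K = bidisc i p"
  have [measurable]: "K \<in> sets borel" by (simp add: K_def borel_bidisc)
  have gap: "\<delta> \<le> 1 - (norm x)\<^sup>2" if "x \<in> K" for x using bidisc_gap that by (auto simp: K_def p_def)
  define w :: "complex ^ 'n" where "w = axis i 1"
  have w: "norm w = 1" by (simp add: w_def)
  obtain C where C: "orthonormal_basis_of UNIV (line_frame w \<union> C)" "orthonormal_basis_of (span C) C"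
    "card C + 2 = dim (UNIV :: (complex ^ 'n) set)"
    "\<And>f. f \<in> borel_measurable borel \<Longrightarrow> (\<integral>\<^sup>+x. f x \<partial>basis_lebesgue (line_frame w \<union> C))
        = (\<integral>\<^sup>+y. \<integral>\<^sup>+z. f (y + z) \<partial>basis_lebesgue C \<partial>basis_lebesgue (line_frame w))"
    "\<And>y z. y \<in> span (line_frame w) \<Longrightarrow> z \<in> span C \<Longrightarrow> (norm (y + z))\<^sup>2 = (norm y)\<^sup>2 + (norm z)\<^sup>2"
    "\<And>y z. y \<in> span (line_frame w) \<Longrightarrow> z \<in> span C \<Longrightarrow> (cmod (herm (y + z) w))\<^sup>2 = (norm y)\<^sup>2"
    by (rule complex_line_split[OF subspace_UNIV UNIV_I UNIV_I w]) (rule that)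
  have cC: "card C = 2 * (N - 1)" using C(3) by (simp add: N_def)
  define S where "S = {x :: complex ^ 'n. p - \<delta> < (norm x)\<^sup>2 \<and> (norm x)\<^sup>2 \<le> p}"
  define A where "A = {x :: complex ^ 'n. p - \<delta> < (cmod (x $ i))\<^sup>2 \<and> (cmod (x $ i))\<^sup>2 \<le> p \<and>
    p - \<delta> < (norm x)\<^sup>2 - (cmod (x $ i))\<^sup>2 \<and> (norm x)\<^sup>2 - (cmod (x $ i))\<^sup>2 \<le> p}"
  have [measurable]: "(\<lambda>x :: complex ^ 'n. x $ i) \<in> borel_measurable borel"
    by (intro borel_measurable_continuous_onI continuous_intros)
  have [measurable]: "S \<in> sets borel" "A \<in> sets borel" unfolding S_def A_def by measurable
  define V1 V2 where "V1 = unit_ball_vol 2" and "V2 = unit_ball_vol (2 * (N - 1))"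
  have V0: "V1 \<ge> 0" "V2 \<ge> 0" by (auto simp: V1_def V2_def)
  have p: "1/4 \<le> p - \<delta>" "p - \<delta> \<le> p" "0 < p - \<delta>" using \<delta> by (auto simp: p_def field_simps)
  have "emeasure (basis_lebesgue (line_frame w)) S * emeasure (basis_lebesgue C) S = emeasure lborel A"
  proof -
    have "emeasure lborel A = (\<integral>\<^sup>+x. indicator A x \<partial>basis_lebesgue (line_frame w \<union> C))"
      using lborel_eq_basis_lebesgue[OF C(1)] by simp
    also have "\<dots> = (\<integral>\<^sup>+y. \<integral>\<^sup>+z. indicator A (y + z) \<partial>basis_lebesgue C \<partial>basis_lebesgue (line_frame w))"
      by (rule C(4)) measurable
    also have "\<dots> = (\<integral>\<^sup>+y. indicator S y * emeasure (basis_lebesgue C) S \<partial>basis_lebesgue (line_frame w))"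
    proof (rule nn_integral_basis_lebesgue_cong)
      fix y assume y: "y \<in> span (line_frame w)"
      have "(\<integral>\<^sup>+z. indicator A (y + z) \<partial>basis_lebesgue C) = (\<integral>\<^sup>+z. indicator S y * indicator S z \<partial>basis_lebesgue C)"
      proof (rule nn_integral_basis_lebesgue_cong)
        fix z assume z: "z \<in> span C"
        have "(cmod ((y + z) $ i))\<^sup>2 = (norm y)\<^sup>2"
          using C(6)[OF y z] unfolding w_def herm_axis_right .
        then have "y + z \<in> A \<longleftrightarrow> y \<in> S \<and> z \<in> S"
          using C(5)[OF y z] by (auto simp: A_def S_def simp del: vector_add_component)
        then show "indicator A (y + z) = (indicator S y * indicator S z :: ennreal)" by (simp add: indicator_def)
      qed measurable
      then show "(\<integral>\<^sup>+z. indicator A (y + z) \<partial>basis_lebesgue C) = indicator S y * emeasure (basis_lebesgue C) S"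
        by (simp add: nn_integral_cmult)
    qed (use orthonormal_basis_of_facts(1)[OF C(2)] in \<open>(intro borel_measurable_nn_integral_basis_lebesgue; measurable), measurable\<close>)
    finally show ?thesis by (simp add: nn_integral_multc)
  qed
  moreover have "ennreal (V1 * \<delta>) \<le> emeasure (basis_lebesgue (line_frame w)) S"
    using emeasure_basis_lebesgue_shell_ge[OF line_frame(5)[OF w], of 1 "p - \<delta>" p] line_frame(4)[OF w] p
    by (simp add: S_def V1_def)
  moreover have "ennreal (V2 * (1/4) ^ (N - 2) * \<delta>) \<le> emeasure (basis_lebesgue C) S"
  proof -
    have "(1/4) ^ (N - 2) \<le> (p - \<delta>) ^ (N - 2)" using p by (intro power_mono) auto
    then have "ennreal (V2 * (1/4) ^ (N - 2) * \<delta>) \<le> ennreal (V2 * (p - \<delta>) ^ (N - 2) * \<delta>)"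
      using V0 \<delta> by (intro ennreal_leI mult_right_mono mult_left_mono) auto
    also have "\<dots> \<le> emeasure (basis_lebesgue C) S"
      using emeasure_basis_lebesgue_shell_ge[OF C(2) cC, of "p - \<delta>" p] N3 p
      by (simp add: S_def V2_def numeral_2_eq_2)
    finally show ?thesis .
  qed
  ultimately have mA: "ennreal (V1 * \<delta>) * ennreal (V2 * (1/4) ^ (N - 2) * \<delta>) \<le> emeasure lborel A"
    by (metis mult_mono zero_le)
  have "V1 * V2 / (3 ^ (N + 1) * 4 ^ (N - 2)) / \<delta> ^ (N - 1) = 1 / (3 * \<delta>) ^ (N + 1) * (V1 * \<delta> * (V2 * (1/4) ^ (N - 2) * \<delta>))"
  proof -
    obtain k where k: "N = k + 2" using N3 by (intro that[of "N - 2"]) auto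
    show ?thesis using \<delta> by (simp add: k power_mult_distrib power_divide field_simps)
  qed
  then have "ennreal (V1 * V2 / (3 ^ (N + 1) * 4 ^ (N - 2)) / \<delta> ^ (N - 1))
      = ennreal (1 / (3 * \<delta>) ^ (N + 1)) * (ennreal (V1 * \<delta>) * ennreal (V2 * (1/4) ^ (N - 2) * \<delta>))"
    using V0 \<delta> by (simp add: ennreal_mult[symmetric] del: power_Suc)
  also have "\<dots> \<le> ennreal (1 / (3 * \<delta>) ^ (N + 1)) * emeasure lborel A"
    using mA by (rule mult_left_mono) simp
  also have "\<dots> \<le> (\<integral>\<^sup>+x\<in>K. ennreal (1 / (1 - (norm x)\<^sup>2) ^ (N + 1)) \<partial>lborel)"
    using \<delta> by (intro nn_integral_inverse_power_ge) (auto simp: K_def A_def bidisc_def p_def field_simps)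
  also have "\<dots> = ennreal (LINT x:K|lborel. 1 / (1 - (norm x)\<^sup>2) ^ (N + 1))"
    using gap by (intro set_lebesgue_integral_inverse_power(1)[OF _ emeasure_lborel_unit_cball _ \<delta>(1)]) auto
  finally have "V1 * V2 / (3 ^ (N + 1) * 4 ^ (N - 2)) / \<delta> ^ (N - 1) \<le> (LINT x:K|lborel. 1 / (1 - (norm x)\<^sup>2) ^ (N + 1))"
    using gap by (subst (asm) ennreal_le_iff)
      (intro set_lebesgue_integral_inverse_power(2)[OF _ emeasure_lborel_unit_cball _ \<delta>(1)], auto)
  then show ?thesis
    unfolding hvol_def N_def[symmetric] K_def p_def V1_def V2_def by (intro mult_left_mono) auto
qed

text \<open>
  With \<open>\<delta> = s ^ (N - 1)\<close> and \<open>e = \<alpha> * s ^ (N - 2)\<close> the powers of \<open>s\<close> in the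
  first inequality cancel, and it holds for small \<open>\<alpha>\<close>. In the second one they leave one factor
  \<open>s\<close>, because \<open>(N - 1) ^ 2 = N * (N - 2) + 1\<close>; so it holds for \<open>s\<close> small depending on
  \<open>\<alpha>\<close>.
\<close>

lemma separating_scales:
  fixes a b c d :: real
  assumes "N \<ge> 3" "a > 0" "b > 0" "c > 0" "d > 0"
  obtains \<delta> e where "0 < \<delta>" "\<delta> \<le> 1/6" "0 < e" "e \<le> 1/4"
    "a / \<delta> ^ (N - 2) \<le> b / e ^ (N - 1)" "c / e ^ N < d / \<delta> ^ (N - 1)"
proof -
  obtain m where m: "N = m + 2" "m \<ge> 1" using assms(1) by (intro that[of "N - 2"]) auto
  define \<alpha> where "\<alpha> = min (1/4) (b / a)"
  have \<alpha>: "0 < \<alpha>" "\<alpha> \<le> 1/4" "\<alpha> * a \<le> b"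
    using assms by (auto simp: \<alpha>_def min_def field_simps)
  define s where "s = min (1/6) (d * \<alpha> ^ N / (2 * c))"
  have s: "0 < s" "s \<le> 1/6" "s * c < d * \<alpha> ^ N"
  proof -
    show "0 < s" using assms \<alpha> by (auto simp: s_def)
    have "s \<le> d * \<alpha> ^ N / (2 * c)" by (simp add: s_def)
    then have "s * c \<le> d * \<alpha> ^ N / 2" using assms by (simp add: field_simps)
    moreover have "0 < d * \<alpha> ^ N" using assms \<alpha> by simp
    ultimately show "s * c < d * \<alpha> ^ N" by linarith
  qed (simp add: s_def)
  have "s ^ (m + 1) \<le> s ^ 1" using s m by (intro power_decreasing) auto
  then have \<delta>: "0 < s ^ (m + 1)" "s ^ (m + 1) \<le> 1/6" using s by (simp, simp only: power_one_right)
  have "\<alpha> * s ^ m \<le> \<alpha> * 1" using \<alpha> s by (intro mult_left_mono power_le_one) auto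
  then have e: "0 < \<alpha> * s ^ m" "\<alpha> * s ^ m \<le> 1/4" using \<alpha> s by (simp, linarith)
  have "a / (s ^ (m + 1)) ^ (N - 2) \<le> b / (\<alpha> * s ^ m) ^ (N - 1)"
  proof -
    have "\<alpha> ^ (m + 1) \<le> \<alpha> ^ 1" using \<alpha> by (intro power_decreasing) auto
    then have "\<alpha> ^ (m + 1) * a \<le> \<alpha> * a" using assms by (intro mult_right_mono) auto
    then have "\<alpha> ^ (m + 1) * a \<le> b" using \<alpha>(3) by linarith
    then have "a \<le> b / \<alpha> ^ (m + 1)" using \<alpha> by (simp add: le_divide_eq mult.commute)
    then have "a / (s ^ m) ^ (m + 1) \<le> b / \<alpha> ^ (m + 1) / (s ^ m) ^ (m + 1)"
      using s by (intro divide_right_mono) auto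
    moreover have "(s ^ (m + 1)) ^ (N - 2) = (s ^ m) ^ (m + 1)" by (simp add: m power_mult[symmetric] mult.commute del: power_Suc)
    moreover have "(\<alpha> * s ^ m) ^ (N - 1) = \<alpha> ^ (m + 1) * (s ^ m) ^ (m + 1)" by (simp add: m power_mult_distrib)
    ultimately show ?thesis by simp
  qed
  moreover have "c / (\<alpha> * s ^ m) ^ N < d / (s ^ (m + 1)) ^ (N - 1)"
  proof -
    have "c < d * \<alpha> ^ N / s" using s by (simp add: field_simps)
    then have "c / \<alpha> ^ N < d / s" using \<alpha> s by (simp add: field_simps)
    then have "c / \<alpha> ^ N / s ^ (m * N) < d / s / s ^ (m * N)" using s by (intro divide_strict_right_mono) auto
    moreover have "(\<alpha> * s ^ m) ^ N = \<alpha> ^ N * s ^ (m * N)" by (simp add: power_mult_distrib power_mult)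
    moreover have "(s ^ (m + 1)) ^ (N - 1) = s * s ^ (m * N)"
    proof -
      have "(m + 1) * (N - 1) = Suc (m * N)" by (simp add: m algebra_simps)
      then show ?thesis by (metis power_Suc power_mult)
    qed
    ultimately show ?thesis by simp
  qed
  ultimately show ?thesis using that \<delta> e by blast
qed

lemma high_dim_counterexample:
  assumes N: "3 \<le> CARD('n)"
  shows "\<exists>K L :: (complex ^ 'n) set.
              convex_body K \<and> R_invariant K \<and> K \<subseteq> ball 0 1 \<and>
              convex_body L \<and> R_invariant L \<and> L \<subseteq> ball 0 1 \<and>
              (\<forall>\<xi>\<in>sphere 0 1. hvol_section K \<xi> \<le> hvol_section L \<xi>) \<and>
              hvol K > hvol L"
proof -
  define N where "N = CARD('n)"
  have N3: "N \<ge> 3" using N by (simp add: N_def)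
  obtain i :: 'n where True by blast
  define a b c d where "a = section_layer_const N * 8"
    and "b = unit_ball_vol (2 * (N - 1)) / 2 ^ (2 * N - 2)"
    and "c = unit_ball_vol (2 * N) * N * 4"
    and "d = unit_ball_vol 2 * unit_ball_vol (2 * (N - 1)) / (3 ^ (N + 1) * 4 ^ (N - 2))"
  have "a > 0" "b > 0" "c > 0" "d > 0"
    using N3 section_layer_const_pos[of N] by (auto simp: a_def b_def c_def d_def)
  then obtain \<delta> e where \<delta>: "0 < \<delta>" "\<delta> \<le> 1/6" and e: "0 < e" "e \<le> 1/4"
    and ab: "a / \<delta> ^ (N - 2) \<le> b / e ^ (N - 1)" and cd: "c / e ^ N < d / \<delta> ^ (N - 1)"
    using separating_scales[OF N3] by metis
  define K where "K = bidisc i ((1 - \<delta>) / 2)"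
  define L where "L = cball (0 :: complex ^ 'n) (sqrt (1 - e))"
  have "convex_body K" "R_invariant K" using bidisc_body[of "(1 - \<delta>) / 2" i] \<delta> by (auto simp: K_def)
  moreover have "K \<subseteq> ball 0 1"
  proof
    fix x assume "x \<in> K"
    then have "\<delta> \<le> 1 - (norm x)\<^sup>2" using bidisc_gap by (auto simp: K_def)
    then have "(norm x)\<^sup>2 < 1" using \<delta> by linarith
    then show "x \<in> ball 0 1" by (simp add: abs_square_less_1)
  qed
  moreover have "convex_body L" "R_invariant L" "L \<subseteq> ball 0 1"
    using cball_body[of "sqrt (1 - e)"] e by (auto simp: L_def)
  moreover have "hvol_section K \<xi> \<le> hvol_section L \<xi>" if "\<xi> \<in> sphere 0 1" for \<xi>
  proof -
    have \<xi>: "norm \<xi> = 1" using that by simp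
    have "hvol_section K \<xi> \<le> 8 ^ (N - 1) * (a / \<delta> ^ (N - 2))"
      using hvol_section_bidisc_le[OF N \<xi> \<delta>(1), of i] by (simp add: K_def a_def N_def)
    also have "\<dots> \<le> 8 ^ (N - 1) * (b / e ^ (N - 1))" using ab by (intro mult_left_mono) auto
    also have "\<dots> \<le> hvol_section L \<xi>"
      using hvol_section_cball_ge[OF N \<xi> e] by (simp add: L_def b_def N_def)
    finally show ?thesis .
  qed
  moreover have "hvol L < hvol K"
  proof -
    have "hvol L \<le> 8 ^ N * (c / e ^ N)" using hvol_cball_le[where 'n='n, of e] e by (simp add: L_def c_def N_def)
    also have "\<dots> < 8 ^ N * (d / \<delta> ^ (N - 1))" using cd by (intro mult_strict_left_mono) auto
    also have "\<dots> \<le> hvol K" using hvol_bidisc_ge[OF N \<delta>, of i] by (simp add: K_def d_def N_def)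
    finally show ?thesis .
  qed
  ultimately show ?thesis by blast
qed

theorem theorem4:
  shows "(CARD('n) = 1 \<longrightarrow>
           (\<forall>K :: (complex ^ 'n) set. convex_body K \<and> R_invariant K \<longrightarrow>
              (\<exists>r>0. K = cball 0 r)))
       \<and> (CARD('n) = 2 \<longrightarrow>
           (\<forall>K L :: (complex ^ 'n) set.
              convex_body K \<and> R_invariant K \<and> K \<subseteq> ball 0 1 \<longrightarrow>
              convex_body L \<and> R_invariant L \<and> L \<subseteq> ball 0 1 \<longrightarrow>
              (\<forall>\<xi>\<in>sphere 0 1. hvol_section K \<xi> \<le> hvol_section L \<xi>) \<longrightarrow>
              hvol K \<le> hvol L))
       \<and> (3 \<le> CARD('n) \<longrightarrow>
           (\<exists>K L :: (complex ^ 'n) set.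
              convex_body K \<and> R_invariant K \<and> K \<subseteq> ball 0 1 \<and>
              convex_body L \<and> R_invariant L \<and> L \<subseteq> ball 0 1 \<and>
              (\<forall>\<xi>\<in>sphere 0 1. hvol_section K \<xi> \<le> hvol_section L \<xi>) \<and>
              hvol K > hvol L))"
proof (intro conjI impI allI)
  fix K :: "(complex ^ 'n) set"
  assume "CARD('n) = 1" "convex_body K \<and> R_invariant K"
  then show "\<exists>r>0. K = cball 0 r" using dim1_body_is_disc by blast
next
  fix K L :: "(complex ^ 'n) set"
  assume n: "CARD('n) = 2" and K: "convex_body K \<and> R_invariant K \<and> K \<subseteq> ball 0 1"
    and L: "convex_body L \<and> R_invariant L \<and> L \<subseteq> ball 0 1"
    and le: "\<forall>\<xi>\<in>sphere 0 1. hvol_section K \<xi> \<le> hvol_section L \<xi>"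
  have "K \<subseteq> L" using dim2_section_comparison_subset[OF n, of K L] K L le by simp
  then show "hvol K \<le> hvol L" using K L by (intro hvol_mono) (auto simp: convex_body_def)
next
  assume "3 \<le> CARD('n)"
  then show "\<exists>K L :: (complex ^ 'n) set.
              convex_body K \<and> R_invariant K \<and> K \<subseteq> ball 0 1 \<and>
              convex_body L \<and> R_invariant L \<and> L \<subseteq> ball 0 1 \<and>
              (\<forall>\<xi>\<in>sphere 0 1. hvol_section K \<xi> \<le> hvol_section L \<xi>) \<and>
              hvol K > hvol L"
    by (rule high_dim_counterexample)
qed

end
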